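(* Let $k\ge 2$ be an integer. The function $$f_k(n)=\frac{\log d_k(n)\,\log\log n}{\log k\,\log n},\qquad n\ge 3 \text{ an integer},$$ has a maximum value $\lambda(k)$, attained at a superior $k$-highly composite number $N_{\max}(k)$ associated to a positive number $\varepsilon(k)$, such that the following holds. Let $\varepsilon_1$ be any positive number with $\varepsilon_1\le \varepsilon_0(k)$, and let $\varepsilon_2$ be any positive admissible number (admissible in the sense defined in the context). If $$\lambda_1:=\frac{(\log k+\varepsilon_1\log c_1(k))^2}{(\log k)\,\bigl(\log k+[\log c_1(k)-1]\,\varepsilon_1\bigr)}<\lambda(k),$$ then $\varepsilon_1\le\varepsilon(k)\le\varepsilon_2$.
   Context: For positive integers $k,n$, $d_k(n)$ is the number of ways to write $n$ as an ordered product of $k$ positive integers. For $\varepsilon>0$, a positive integer $N$ is a superior $k$-highly composite number associated to $\varepsilon$ if $d_k(n)/n^{\varepsilon}\le d_k(N)/N^{\varepsilon}$ for all positive integers $n$. Define $$\varepsilon_0(k)=\frac{\log\frac{k+1}{2}}{\log 8},\qquad c_1(k)=\frac{k-1}{2e\log\frac{2k}{k+1}}+\omega_2,\qquad \omega_2=1.00001.$$ A positive number $\varepsilon_2$ is called admissible (for $k$) if there is a superior $k$-highly composite number $N_2$ associated to $\varepsilon_2$ such that $N_2>e^{e^2}$ and $0\le \log d_k(N_2)-\varepsilon_2\log N_2\le e^2\varepsilon_2$. *)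

theory Defs
  imports Complex_Main
begin

definition dfact :: "nat \<Rightarrow> nat \<Rightarrow> nat" where
  "dfact k n = card {xs :: nat list. length xs = k \<and> (\<forall>x\<in>set xs. x > 0) \<and> prod_list xs = n}"

definition superior_highly_composite :: "nat \<Rightarrow> real \<Rightarrow> nat \<Rightarrow> bool" where
  "superior_highly_composite k \<epsilon> N \<longleftrightarrow> \<epsilon> > 0 \<and> N > 0 \<and>
     (\<forall>n>0. real (dfact k n) / real n powr \<epsilon> \<le> real (dfact k N) / real N powr \<epsilon>)"

definition fratio :: "nat \<Rightarrow> nat \<Rightarrow> real" where
  "fratio k n = (ln (real (dfact k n)) * ln (ln (real n))) / (ln (real k) * ln (real n))"

definition \<epsilon>\<^sub>0 :: "nat \<Rightarrow> real" where
  "\<epsilon>\<^sub>0 k = ln ((real k + 1) / 2) / ln 8"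

definition \<omega>\<^sub>2 :: real where
  "\<omega>\<^sub>2 = 1.00001"

definition c\<^sub>1 :: "nat \<Rightarrow> real" where
  "c\<^sub>1 k = (real k - 1) / (2 * exp 1 * ln (2 * real k / (real k + 1))) + \<omega>\<^sub>2"

definition admissible :: "nat \<Rightarrow> real \<Rightarrow> bool" where
  "admissible k \<epsilon>\<^sub>2 \<longleftrightarrow> \<epsilon>\<^sub>2 > 0 \<and>
     (\<exists>N\<^sub>2. superior_highly_composite k \<epsilon>\<^sub>2 N\<^sub>2 \<and> real N\<^sub>2 > exp (exp 2) \<and>
        0 \<le> ln (real (dfact k N\<^sub>2)) - \<epsilon>\<^sub>2 * ln (real N\<^sub>2) \<and>
        ln (real (dfact k N\<^sub>2)) - \<epsilon>\<^sub>2 * ln (real N\<^sub>2) \<le> exp 2 * \<epsilon>\<^sub>2)"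

definition lambda\<^sub>1 :: "nat \<Rightarrow> real \<Rightarrow> real" where
  "lambda\<^sub>1 k \<epsilon>\<^sub>1 = (ln (real k) + \<epsilon>\<^sub>1 * ln (c\<^sub>1 k))\<^sup>2 /
     (ln (real k) * (ln (real k) + (ln (c\<^sub>1 k) - 1) * \<epsilon>\<^sub>1))"

end

theory Submission
  imports Defs "HOL-Computational_Algebra.Primes" "HOL-Analysis.Harmonic_Numbers"
    "HOL-Real_Asymp.Real_Asymp"
begin

text \<open>
  Write \<open>K = ln k\<close> and \<open>\<phi>(t) = t / ln t\<close>, so that \<open>fratio k n = ln (d\<^sub>k n) / (K \<phi>(ln n))\<close>.

  \<^bold>\<open>The maximum.\<close> For \<open>t > 1\<close> the function \<open>\<phi>\<close> is convex up to \<open>t = e\<^sup>2\<close> and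
  concave from there on. Continuing the concave part to the left of
  \<open>e\<^sup>2\<close> by its tangent gives a concave function, the envelope, which is at most \<open>\<phi>\<close> for \<open>t > 1\<close>. The
  quotient of \<open>ln (d\<^sub>k n)\<close> by \<open>K\<close> times the envelope has a maximum: it is at least \<open>6/5\<close> at \<open>n = 210\<close>,
  and an elementary form of Wigert's estimate keeps it at most \<open>6/5\<close> for large \<open>n\<close>
  (\<open>exists_maximizer\<close>). Let \<open>\<lambda>\<close> be the maximum, \<open>N\<close> a maximizer and \<open>L = ln (ln N)\<close>. By concavity the
  tangent of the envelope at \<open>ln N\<close> lies above the envelope, which says that \<open>N\<close> is superior highly
  composite with \<open>\<epsilon> = \<lambda> K \<phi>'(ln N) = \<lambda> K (L - 1) / L\<^sup>2\<close>. If \<open>ln N \<ge> e\<^sup>2\<close>, the envelope agrees with \<open>\<phi>\<close> at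
  \<open>ln N\<close>, and \<open>\<lambda>\<close> is the maximum of \<open>fratio k\<close> as well.

  \<^bold>\<open>The maximizer is large.\<close> If \<open>ln N < e\<^sup>2\<close>, then \<open>N < 1728\<close>, and \<open>N\<close> is superior highly composite for
  the slope \<open>\<mu> = \<lambda> K / 4\<close> of the tangent at \<open>e\<^sup>2\<close>, with \<open>ln (d\<^sub>k N) = \<mu> (e\<^sup>2 + ln N)\<close>. For such an \<open>N\<close>
  the exponents are so restricted that \<open>ln (d\<^sub>k N) \<le> 2 \<mu> ln N\<close> (locale \<open>small_superior\<close>), a
  contradiction. The reason is the inequality \<open>C(k+a-1, a) \<le> ((k+a)/(a+1))\<^sup>2\<^sup>a\<close>, valid unless \<open>a\<close> is large
  compared with \<open>k\<close>, together with \<open>(k+a)/(a+1) \<le> p\<^sup>\<mu>\<close> for the exponent \<open>a\<close> of the prime \<open>p\<close>.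

  \<^bold>\<open>The upper bound for \<epsilon>.\<close> The number \<open>max\<^sub>n (ln (d\<^sub>k n) - \<epsilon> ln n)\<close> decreases with \<open>\<epsilon>\<close>. At the
  maximizer it is \<open>\<epsilon> e\<^sup>L / (L - 1)\<close>, and \<open>e\<^sup>L / (L - 1) \<ge> e\<^sup>2\<close>. For an admissible \<open>\<epsilon>\<^sub>2\<close> it is at most
  \<open>e\<^sup>2 \<epsilon>\<^sub>2\<close>. Hence \<open>\<epsilon> \<le> \<epsilon>\<^sub>2\<close>.

  \<^bold>\<open>The lower bound for \<epsilon>.\<close> If \<open>\<epsilon> < \<epsilon>\<^sub>1 \<le> \<epsilon>\<^sub>0 k\<close>, then \<open>ln N \<le> c\<^sub>1 k \<cdot> k\<^bsup>1/\<epsilon>\<^esup>\<close>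
  (\<open>ln_superior_le_c_1\<close>), that is, \<open>L \<le> ln (c\<^sub>1 k) + K / \<epsilon>\<close>. Since \<open>\<lambda> = \<epsilon> L\<^sup>2 / (K (L - 1))\<close> and
  \<open>L\<^sup>2 / (L - 1)\<close> increases for \<open>L \<ge> 2\<close>, this gives \<open>\<lambda> \<le> lambda\<^sub>1 k \<epsilon> \<le> lambda\<^sub>1 k \<epsilon>\<^sub>1\<close>.

  \<^bold>\<open>The bound for \<open>ln N\<close>.\<close> With \<open>s = 1/\<epsilon>\<close>, \<open>x\<^sub>1 = k\<^sup>s\<close> and \<open>x\<^sub>2 = ((k+1)/2)\<^sup>s\<close>, the primes between \<open>x\<^sub>2\<close>
  and \<open>x\<^sub>1\<close> have exponent at most 1 in \<open>N\<close>, and a prime \<open>p \<le> x\<^sub>2\<close> contributes at most \<open>(k-1) s\<close> to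
  \<open>ln N\<close>; so \<open>ln N \<le> \<pi>(x\<^sub>2) (k-1) s + \<theta>(x\<^sub>1) - \<theta>(x\<^sub>2)\<close>. As \<open>\<epsilon> \<le> \<epsilon>\<^sub>0 k\<close> means \<open>x\<^sub>2 \<ge> 8\<close>, we have
  \<open>\<pi>(x\<^sub>2) \<le> x\<^sub>2 / 2\<close>, and maximizing over \<open>s\<close> bounds the first summand by \<open>(c\<^sub>1 k - \<omega>\<^sub>2) x\<^sub>1\<close>. The
  Chebyshev function is treated by elementary means: for \<open>x\<^sub>1 \<le> 512\<close> a table shows \<open>\<theta>(x\<^sub>1) \<le> x\<^sub>1 + ln 210\<close>, and \<open>ln 210 \<le> \<theta>(x\<^sub>2)\<close>; for \<open>x\<^sub>1 > 512\<close> the estimate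
  \<open>\<theta>(x\<^sub>1) \<le> x\<^sub>1 ln 4\<close> is good enough, because then the first summand stays below its bound by at
  least \<open>7/18 x\<^sub>1\<close>, which exceeds \<open>(ln 4 - 1) x\<^sub>1\<close>.
\<close>

section \<open>The divisor function on prime powers\<close>

lemma dfact_0: "dfact 0 n = (if n = 1 then 1 else 0)"
proof -
  have "{xs :: nat list. length xs = 0 \<and> (\<forall>x\<in>set xs. x > 0) \<and> prod_list xs = n} =
      (if n = 1 then {[]} else {})"
    by auto
  then show ?thesis
    unfolding dfact_def by simp
qed

lemma finite_factorizations:
  assumes "n > 0"
  shows "finite {xs :: nat list. length xs = k \<and> (\<forall>x\<in>set xs. x > 0) \<and> prod_list xs = n}"
proof (rule finite_subset)
  show "{xs. length xs = k \<and> (\<forall>x\<in>set xs. x > 0) \<and> prod_list xs = n} \<subseteq>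
      {xs. set xs \<subseteq> {..n} \<and> length xs = k}"
  proof (intro subsetI CollectI conjI)
    fix xs :: "nat list" and x
    assume xs: "xs \<in> {xs. length xs = k \<and> (\<forall>x\<in>set xs. x > 0) \<and> prod_list xs = n}" and "x \<in> set xs"
    then have "x dvd n" using prod_list_dvd[of x xs] by simp
    then show "x \<in> {..n}" using assms by (auto intro: dvd_imp_le)
  qed auto
qed (simp add: finite_lists_length_eq)

lemma dfact_Suc:
  assumes "n > 0"
  shows "dfact (Suc k) n = (\<Sum>d | d dvd n. dfact k (n div d))"
proof -
  define S where "S k n = {xs :: nat list. length xs = k \<and> (\<forall>x\<in>set xs. x > 0) \<and> prod_list xs = n}"
    for k n
  have "S (Suc k) n = (\<Union>d\<in>{d. d dvd n}. (#) d ` S k (n div d))"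
  proof (intro equalityI subsetI)
    fix xs assume "xs \<in> S (Suc k) n"
    then obtain d ys where "xs = d # ys" "length ys = k" "d > 0" "\<forall>x\<in>set ys. x > 0" "d * prod_list ys = n"
      unfolding S_def by (cases xs) auto
    then have "d \<in> {d. d dvd n}" "ys \<in> S k (n div d)"
      unfolding S_def by auto
    then show "xs \<in> (\<Union>d\<in>{d. d dvd n}. (#) d ` S k (n div d))"
      using \<open>xs = d # ys\<close> by blast
  next
    fix xs assume "xs \<in> (\<Union>d\<in>{d. d dvd n}. (#) d ` S k (n div d))"
    then show "xs \<in> S (Suc k) n"
      using assms dvd_pos_nat[of n] unfolding S_def by auto
  qed
  moreover have "card (\<Union>d\<in>{d. d dvd n}. (#) d ` S k (n div d)) =
      (\<Sum>d | d dvd n. card ((#) d ` S k (n div d)))"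
  proof (rule card_UN_disjoint)
    show "finite {d. d dvd n}"
      using assms by simp
    have "finite (S k (n div d))" if "d dvd n" for d
      unfolding S_def using that assms
      by (intro finite_factorizations) (simp add: div_greater_zero_iff dvd_imp_le dvd_pos_nat)
    then show "\<forall>d\<in>{d. d dvd n}. finite ((#) d ` S k (n div d))"
      by simp
  qed auto
  ultimately show ?thesis
    unfolding dfact_def S_def[symmetric] by (simp add: card_image)
qed

lemma divisors_prime_power_mult:
  fixes p a m :: nat
  assumes "prime p" "\<not> p dvd m" "m > 0"
  shows "bij_betw (\<lambda>(i, e). p ^ i * e) ({..a} \<times> {e. e dvd m}) {d. d dvd p ^ a * m}"
proof (rule bij_betw_imageI)
  have *: "multiplicity p (p ^ i * e) = i" if "e dvd m" for i e
  proof -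
    have "e \<noteq> 0" "\<not> p dvd e" using that assms dvd_trans[of p e m] by auto
    then show ?thesis
      using assms(1) by (simp add: prime_elem_multiplicity_mult_distrib not_dvd_imp_multiplicity_0)
  qed
  show "inj_on (\<lambda>(i, e). p ^ i * e) ({..a} \<times> {e. e dvd m})"
  proof (rule inj_onI, clarsimp)
    fix i e j f assume "e dvd m" "f dvd m" "p ^ i * e = p ^ j * f"
    moreover from this have "i = j" using * by metis
    ultimately show "i = j \<and> e = f" using prime_gt_0_nat[OF assms(1)] by simp
  qed
  show "(\<lambda>(i, e). p ^ i * e) ` ({..a} \<times> {e. e dvd m}) = {d. d dvd p ^ a * m}"
  proof (intro equalityI subsetI)
    fix d assume "d \<in> {d. d dvd p ^ a * m}"
    then have "d dvd p ^ a * m" by simp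
    then obtain b c where "d = b * c" "b dvd p ^ a" "c dvd m"
      by (rule dvd_productE)
    then show "d \<in> (\<lambda>(i, e). p ^ i * e) ` ({..a} \<times> {e. e dvd m})"
      using divides_primepow_nat[OF assms(1), of b a] by (auto intro!: image_eqI[of _ _ "(_, c)"])
  next
    fix d assume "d \<in> (\<lambda>(i, e). p ^ i * e) ` ({..a} \<times> {e. e dvd m})"
    then show "d \<in> {d. d dvd p ^ a * m}"
      by (auto intro!: mult_dvd_mono le_imp_power_dvd)
  qed
qed

lemma sum_multichoose: "(\<Sum>i\<le>a. (k + (a - i) - 1) choose (a - i)) = (k + a) choose a"
proof -
  have "(\<Sum>i\<le>a. (k + (a - i) - 1) choose (a - i)) = (\<Sum>j\<le>a. (k + j - 1) choose j)"
    by (rule sum.reindex_bij_witness[of _ "\<lambda>j. a - j" "\<lambda>i. a - i"]) auto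
  also have "\<dots> = (k + a) choose a"
  proof (cases k)
    case 0
    have "(\<Sum>j\<le>a. (0 + j - 1) choose j) = (\<Sum>j\<le>a. if j = 0 then 1 else 0)"
      by (intro sum.cong) auto
    then show ?thesis using 0 by simp
  next
    case (Suc l)
    then show ?thesis using sum_choose_lower[of l a] by simp
  qed
  finally show ?thesis .
qed

text \<open>
  In the divisor recursion, a divisor of \<open>p\<^sup>a m\<close> splits into a power of \<open>p\<close> and a divisor of \<open>m\<close>, and the
  sum over the powers of \<open>p\<close> is the hockey stick identity. For \<open>k = 0\<close> the truncated subtraction gives
  the right value: the binomial coefficient is 1 for \<open>a = 0\<close> and 0 otherwise.
\<close>

lemma dfact_prime_power_mult:
  assumes "prime p" "\<not> p dvd m" "m > 0"
  shows "dfact k (p ^ a * m) = ((k + a - 1) choose a) * dfact k m"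
  using assms(2,3)
proof (induction k arbitrary: a m)
  case 0
  have "p \<noteq> 1" using assms(1) by auto
  then have "p ^ a * m = 1 \<longleftrightarrow> a = 0 \<and> m = 1"
    by simp
  then show ?case
    using \<open>p \<noteq> 1\<close> by (cases a) (simp_all add: dfact_0)
next
  case (Suc k)
  have p: "p > 0" using assms(1) by (rule prime_gt_0_nat)
  have "dfact (Suc k) (p ^ a * m) = (\<Sum>d | d dvd p ^ a * m. dfact k ((p ^ a * m) div d))"
    using Suc.prems p by (intro dfact_Suc) simp
  also have "\<dots> = (\<Sum>(i, e)\<in>{..a} \<times> {e. e dvd m}. dfact k ((p ^ a * m) div (p ^ i * e)))"
    using sum.reindex_bij_betw[OF divisors_prime_power_mult[OF assms(1) Suc.prems],
        of "\<lambda>d. dfact k ((p ^ a * m) div d)" a]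
    by (simp add: case_prod_unfold)
  also have "\<dots> = (\<Sum>(i, e)\<in>{..a} \<times> {e. e dvd m}.
      ((k + (a - i) - 1) choose (a - i)) * dfact k (m div e))"
  proof (rule sum.cong[OF refl])
    fix x assume x: "x \<in> {..a} \<times> {e. e dvd m}"
    obtain i e where xe: "x = (i, e)" by (cases x)
    then have ie: "i \<le> a" "e dvd m" using x by auto
    obtain f where f: "m = e * f" using ie(2) by (rule dvdE)
    then have f': "m div e = f" "f > 0" "e > 0" using Suc.prems(2) by auto
    then have nd: "\<not> p dvd m div e" "m div e > 0" using f Suc.prems(1) by auto
    have "p ^ a = p ^ (i + (a - i))" using ie(1) by simp
    also have "\<dots> = p ^ i * p ^ (a - i)" by (rule power_add)
    finally have "p ^ a * m = (p ^ i * p ^ (a - i)) * (e * (m div e))"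
      unfolding f'(1) f[symmetric] by (rule arg_cong)
    then have "p ^ a * m = (p ^ i * e) * (p ^ (a - i) * (m div e))"
      by (simp only: mult.assoc mult.left_commute)
    then have eq: "(p ^ a * m) div (p ^ i * e) = p ^ (a - i) * (m div e)"
      using f'(3) p by simp
    show "(case x of (i, e) \<Rightarrow> dfact k ((p ^ a * m) div (p ^ i * e))) =
        (case x of (i, e) \<Rightarrow> ((k + (a - i) - 1) choose (a - i)) * dfact k (m div e))"
      unfolding xe case_prod_conv eq by (rule Suc.IH[OF nd])
  qed
  also have "\<dots> = (\<Sum>i\<le>a. (k + (a - i) - 1) choose (a - i)) * (\<Sum>e | e dvd m. dfact k (m div e))"
    by (simp only: sum_product sum.cartesian_product)
  also have "\<dots> = ((Suc k + a - 1) choose a) * dfact (Suc k) m"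
    unfolding sum_multichoose dfact_Suc[OF Suc.prems(2)] by simp
  finally show ?case .
qed

lemma dfact_1: "dfact k 1 = 1"
proof (induction k)
  case (Suc k)
  then show ?case by (subst dfact_Suc) (simp_all add: dfact_0)
qed (simp add: dfact_0)

lemma split_off_prime:
  fixes n p :: nat
  assumes "n > 0" "prime p"
  obtains m where "n = p ^ multiplicity p n * m" "\<not> p dvd m" "m > 0"
proof -
  obtain m where m: "n = p ^ multiplicity p n * m" "\<not> p dvd m"
    using assms multiplicity_decompose'[of n p] not_prime_unit by (metis gr_implies_not0)
  moreover have "m > 0" using m(2) by (intro Nat.gr0I) auto
  ultimately show thesis by (rule that)
qed

lemma dfact_prime_mult:
  assumes "prime p" "n > 0" "k > 0"
  shows "dfact k (p * n) * (multiplicity p n + 1) = (k + multiplicity p n) * dfact k n"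
proof -
  define a where "a = multiplicity p n"
  obtain m where m: "n = p ^ a * m" "\<not> p dvd m" "m > 0"
    using split_off_prime[OF assms(2,1)] unfolding a_def .
  obtain l where l: "k = Suc l" using assms(3) by (cases k) auto
  have "dfact k (p * n) = dfact k (p ^ Suc a * m)"
    using m(1) by (simp add: mult.assoc)
  also have "\<dots> * (a + 1) = ((k + a) choose Suc a) * (a + 1) * dfact k m"
    by (subst dfact_prime_power_mult[OF assms(1) m(2,3)]) (simp add: algebra_simps)
  also have "((k + a) choose Suc a) * (a + 1) = (k + a) * ((k + a - 1) choose a)"
    using Suc_times_binomial_eq[of "l + a" a] l by (simp add: ac_simps)
  finally show ?thesis
    unfolding a_def[symmetric]
    using dfact_prime_power_mult[OF assms(1) m(2,3), of k a] by (simp only: m(1)[symmetric] mult.assoc)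
qed

lemma prime_factors_split:
  fixes p a m :: nat
  assumes "prime p" "\<not> p dvd m" "m > 0" "a > 0"
  shows "prime_factors (p ^ a * m) = insert p (prime_factors m)"
    and "multiplicity p (p ^ a * m) = a"
    and "q \<in> prime_factors m \<Longrightarrow> multiplicity q (p ^ a * m) = multiplicity q m"
proof -
  show "prime_factors (p ^ a * m) = insert p (prime_factors m)"
    using assms by (simp add: prime_factors_product prime_factorization_prime_power prime_gt_0_nat)
  show "multiplicity p (p ^ a * m) = a"
    using assms by (simp add: prime_elem_multiplicity_mult_distrib not_dvd_imp_multiplicity_0)
  assume "q \<in> prime_factors m"
  then have "prime q" "q dvd m" by auto
  then have "q \<noteq> p" using assms by auto
  then show "multiplicity q (p ^ a * m) = multiplicity q m"
    using \<open>prime q\<close> assms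
    by (simp add: prime_elem_multiplicity_mult_distrib multiplicity_distinct_prime_power)
qed

lemma ln_dfact:
  assumes "n > 0" "k > 0"
  shows "dfact k n > 0 \<and> ln (real (dfact k n)) =
    (\<Sum>p\<in>prime_factors n. ln (real ((k + multiplicity p n - 1) choose multiplicity p n)))"
  using assms(1)
proof (induction n rule: less_induct)
  case (less n)
  show ?case
  proof (cases "n = 1")
    case True
    then show ?thesis using dfact_1 by simp
  next
    case False
    then obtain p where p: "prime p" "p dvd n"
      using prime_factor_nat by blast
    define a where "a = multiplicity p n"
    obtain m where m: "n = p ^ a * m" "\<not> p dvd m" "m > 0"
      using split_off_prime[OF less.prems p(1)] unfolding a_def .
    have "a > 0" using p less.prems unfolding a_def
      by (simp add: prime_multiplicity_gt_zero_iff)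
    then have "p ^ a > 1" using prime_gt_1_nat[OF p(1)] by (rule one_less_power[rotated])
    then have "m < n" using m by simp
    note IH = less.IH[OF this m(3)]
    note s = prime_factors_split[OF p(1) m(2,3) \<open>a > 0\<close>]
    have c: "((k + a - 1) choose a) > 0" using assms(2) by (simp add: zero_less_binomial_iff)
    have d: "dfact k n = ((k + a - 1) choose a) * dfact k m"
      using dfact_prime_power_mult[OF p(1) m(2,3)] m(1) by simp
    have "p \<notin> prime_factors m" using m(2) by auto
    then have "(\<Sum>q\<in>prime_factors n. ln (real ((k + multiplicity q n - 1) choose multiplicity q n))) =
        ln (real ((k + a - 1) choose a)) + (\<Sum>q\<in>prime_factors m. ln (real ((k + multiplicity q m - 1) choose multiplicity q m)))"
    proof -
      have "(\<Sum>q\<in>prime_factors m. ln (real ((k + multiplicity q n - 1) choose multiplicity q n))) =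
          (\<Sum>q\<in>prime_factors m. ln (real ((k + multiplicity q m - 1) choose multiplicity q m)))"
      proof (rule sum.cong[OF refl])
        fix q assume "q \<in> prime_factors m"
        then have "multiplicity q n = multiplicity q m"
          by (subst m(1)) (rule s(3))
        then show "ln (real ((k + multiplicity q n - 1) choose multiplicity q n)) =
            ln (real ((k + multiplicity q m - 1) choose multiplicity q m))"
          by (simp only:)
      qed
      moreover have "prime_factors n = insert p (prime_factors m)"
        by (subst m(1)) (rule s(1))
      ultimately show ?thesis
        using \<open>p \<notin> prime_factors m\<close> by (simp add: a_def[symmetric])
    qed
    moreover have "ln (real (dfact k n)) = ln (real ((k + a - 1) choose a)) + ln (real (dfact k m))"
      unfolding d of_nat_mult using c IH by (intro ln_mult_pos) simp_all
    moreover have "dfact k n > 0" unfolding d using c IH by simp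
    ultimately show ?thesis
      using IH by simp
  qed
qed

lemma ln_eq_sum_prime_factors:
  assumes "n > 0"
  shows "ln (real n) = (\<Sum>p\<in>prime_factors n. real (multiplicity p n) * ln (real p))"
proof -
  have pos: "p > 0" if "p \<in> prime_factors n" for p
    using that by (rule prime_factors_gt_0_nat)
  have "real n = (\<Prod>p\<in>prime_factors n. real p ^ multiplicity p n)"
    unfolding of_nat_power[symmetric] of_nat_prod[symmetric]
    using prime_factorization_nat[OF assms] by (rule arg_cong)
  then have "ln (real n) = ln (\<Prod>p\<in>prime_factors n. real p ^ multiplicity p n)"
    by (rule arg_cong)
  also have "\<dots> = (\<Sum>p\<in>prime_factors n. ln (real p ^ multiplicity p n))"
  proof (rule ln_prod)
    fix p assume "p \<in> prime_factors n"
    then show "real p ^ multiplicity p n \<noteq> 0" using pos[of p] by simp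
  qed simp
  also have "\<dots> = (\<Sum>p\<in>prime_factors n. real (multiplicity p n) * ln (real p))"
    by (intro sum.cong refl ln_realpow)
  finally show ?thesis .
qed

section \<open>Numerical bounds for the exponential and the logarithm\<close>

text \<open>
  This is the Pade bound \<open>exp m \<le> (2 + m) / (2 - m)\<close>, multiplied out so that it makes sense for all
  \<open>m \<ge> 0\<close>. Its error is of third order in \<open>m\<close>, as is the contact of \<open>t / ln t\<close> with its tangent at the inflection
  point, to which it is applied below.
\<close>

lemma exp_mult_le_Moebius:
  fixes m :: real
  assumes "m \<ge> 0"
  shows "exp m * (2 - m) \<le> 2 + m"
proof -
  have "\<exists>y. ((\<lambda>m. 2 + m - exp m * (2 - m)) has_real_derivative y) (at x) \<and> 0 \<le> y" if "0 \<le> x" for x :: real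
  proof (intro exI conjI)
    show "((\<lambda>m. 2 + m - exp m * (2 - m)) has_real_derivative (1 - exp x * (1 - x))) (at x)"
      by (auto intro!: derivative_eq_intros simp: algebra_simps)
    have "exp x * (1 - x) \<le> exp x * exp (- x)"
      using exp_ge_add_one_self[of "- x"] by (intro mult_left_mono) auto
    then show "0 \<le> 1 - exp x * (1 - x)"
      by (simp flip: exp_add)
  qed
  then have "2 + 0 - exp 0 * (2 - 0) \<le> 2 + m - exp m * (2 - m)"
    using assms by (intro DERIV_nonneg_imp_nondecreasing[where f = "\<lambda>m. 2 + m - exp m * (2 - m)"]) auto
  then show ?thesis by simp
qed

lemma exp_1_le: "exp (1::real) \<le> 2.7184" and exp_1_ge: "exp (1::real) \<ge> 2.718"
proof -
  have e: "exp (1::real) = exp (1 / 64) ^ 64"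
    by (simp flip: exp_of_nat_mult)
  have "exp (1 / 64) * (2 - 1 / 64) \<le> 2 + 1 / (64::real)"
    by (intro exp_mult_le_Moebius) simp
  then have "exp (1 / 64) \<le> (129 / 127 :: real)" by simp
  then have "exp (1::real) \<le> (129 / 127) ^ 64"
    unfolding e by (intro power_mono) auto
  also have "\<dots> \<le> 2.7184" by (simp add: power_divide divide_le_eq)
  finally show "exp (1::real) \<le> 2.7184" .
  have "1 + 1 / 64 + (1 / 64)\<^sup>2 / 2 \<le> exp (1 / 64 :: real)"
    by (intro exp_lower_Taylor_quadratic) simp
  then have "(8321 / 8192 :: real) \<le> exp (1 / 64)" by (simp add: power2_eq_square)
  then have "(8321 / 8192 :: real) ^ 64 \<le> exp 1"
    unfolding e by (intro power_mono) auto
  moreover have "2.718 \<le> (8321 / 8192 :: real) ^ 64" by (simp add: power_divide le_divide_eq)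
  ultimately show "exp (1::real) \<ge> 2.718" by linarith
qed

lemma exp_2_le: "exp (2::real) \<le> 7.39" and exp_2_ge: "exp (2::real) \<ge> 7.387"
proof -
  have e: "exp (2::real) = exp 1 * exp 1" by (simp flip: exp_add)
  have "exp (1::real) * exp 1 \<le> 2.7184 * 2.7184"
    using exp_1_le by (intro mult_mono) auto
  then show "exp (2::real) \<le> 7.39" unfolding e by simp
  have "2.718 * 2.718 \<le> exp (1::real) * exp 1"
    using exp_1_ge by (intro mult_mono) auto
  then show "exp (2::real) \<ge> 7.387" unfolding e by simp
qed

lemma le_exp_half_square:
  fixes y :: real
  assumes "y \<ge> 0"
  shows "(1 + y / 2 + (y / 2)\<^sup>2 / 2)\<^sup>2 \<le> exp y"
proof -
  have "1 + y / 2 + (y / 2)\<^sup>2 / 2 \<le> exp (y / 2)"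
    using assms by (intro exp_lower_Taylor_quadratic) simp
  then have "(1 + y / 2 + (y / 2)\<^sup>2 / 2)\<^sup>2 \<le> (exp (y / 2))\<^sup>2"
    using assms by (intro power_mono) auto
  then show ?thesis by (simp flip: exp_double)
qed

lemma exp_le_Moebius_square:
  fixes y :: real
  assumes "0 \<le> y" "y < 4"
  shows "exp y \<le> ((4 + y) / (4 - y))\<^sup>2"
proof -
  have "exp (y / 2) * (2 - y / 2) \<le> 2 + y / 2"
    using assms by (intro exp_mult_le_Moebius) simp
  then have "exp (y / 2) \<le> (4 + y) / (4 - y)"
    using assms by (simp add: field_simps)
  then have "(exp (y / 2))\<^sup>2 \<le> ((4 + y) / (4 - y))\<^sup>2"
    by (intro power_mono) auto
  then show ?thesis by (simp flip: exp_double)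
qed

lemma ln_le_of_square:
  fixes c y :: real
  assumes "c > 0" "y \<ge> 0" "c \<le> (1 + y / 2 + (y / 2)\<^sup>2 / 2)\<^sup>2"
  shows "ln c \<le> y"
  using le_exp_half_square[OF assms(2)] assms ln_mono[of c "exp y"] by simp

lemma ln_ge_of_Moebius:
  fixes c y :: real
  assumes "0 \<le> y" "y < 4" "((4 + y) / (4 - y))\<^sup>2 \<le> c"
  shows "y \<le> ln c"
  using exp_le_Moebius_square[OF assms(1,2)] assms ln_mono[of "exp y" c] by simp

section \<open>A concave minorant of \<open>t / ln t\<close>\<close>

text \<open>
  The left branch is the tangent of \<open>t / ln t\<close> at its inflection point \<open>e\<^sup>2\<close>.
\<close>

definition envelope :: "real \<Rightarrow> real" where
  "envelope t = (if t < exp 2 then (exp 2 + t) / 4 else t / ln t)"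

text \<open>
  The inequality of the tangent for \<open>t / ln t\<close> on \<open>t \<ge> e\<^sup>2\<close>, in the variables \<open>t = e\<^sup>y\<close> and \<open>s = e\<^sup>z\<close>. It
  reduces to \<open>e\<^bsup>z-y\<^esup> \<ge> 1 + d + d\<^sup>2/y\<close> for \<open>d = z - y\<close>: the Taylor bound if \<open>d \<ge> 0\<close>, the Pade bound if \<open>d < 0\<close>.
\<close>

lemma exp_over_id_le_tangent:
  fixes y z :: real
  assumes "y \<ge> 2" "z \<ge> 2"
  shows "exp y / y \<le> exp z / z\<^sup>2 + (z - 1) / z\<^sup>2 * exp y"
proof -
  \<comment> \<open>the claim multiplied by \<open>z\<^sup>2 y exp (- y)\<close>\<close>
  have "z\<^sup>2 - (z - 1) * y \<le> y * exp (z - y)"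
  proof (cases "y \<le> z")
    case True
    define d where "d = z - y"
    have "1 + d + d\<^sup>2 / 2 \<le> exp d"
      using True unfolding d_def by (intro exp_lower_Taylor_quadratic) simp
    then have "y * (1 + d + d\<^sup>2 / 2) \<le> y * exp d"
      using assms by (intro mult_left_mono) auto
    moreover have "2 * d\<^sup>2 \<le> y * d\<^sup>2"
      using assms by (intro mult_right_mono) auto
    moreover have "z\<^sup>2 - (z - 1) * y = y + d * y + d\<^sup>2"
      unfolding d_def by (simp add: power2_eq_square algebra_simps)
    ultimately show ?thesis unfolding d_def[symmetric] by (simp add: algebra_simps)
  next
    case False
    define m where "m = y - z"
    have m: "m > 0" using False by (simp add: m_def)
    have "exp m * (2 - m) \<le> 2 + m" using m by (intro exp_mult_le_Moebius) simp
    then have *: "(2 - m) \<le> (2 + m) * exp (- m)"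
      by (simp add: exp_minus field_simps)
    have "(y * (1 - m) + m\<^sup>2) * (2 + m) \<le> y * (2 - m)"
    proof -
      have "(y * (1 - m) + m\<^sup>2) * (2 + m) - y * (2 - m) = m\<^sup>2 * (2 + m - y)"
        by (simp add: power2_eq_square algebra_simps)
      also have "\<dots> \<le> 0" using assms by (intro mult_nonneg_nonpos) (auto simp: m_def)
      finally show ?thesis by simp
    qed
    also have "\<dots> \<le> y * ((2 + m) * exp (- m))"
      using * assms by (intro mult_left_mono) auto
    finally have "(y * (1 - m) + m\<^sup>2) * (2 + m) \<le> (y * exp (- m)) * (2 + m)"
      by (simp add: algebra_simps)
    then have "y * (1 - m) + m\<^sup>2 \<le> y * exp (- m)"
      using m by (simp add: mult_le_cancel_right)
    moreover have "y * (1 - m) + m\<^sup>2 = z\<^sup>2 - (z - 1) * y"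
      unfolding m_def by (simp add: power2_eq_square algebra_simps)
    ultimately show ?thesis unfolding m_def by simp
  qed
  then have "exp y * (z\<^sup>2 - (z - 1) * y) \<le> exp y * (y * exp (z - y))"
    by (intro mult_left_mono) auto
  also have "\<dots> = y * exp z" by (simp add: exp_diff)
  finally have "exp y * z\<^sup>2 \<le> y * (exp z + (z - 1) * exp y)"
    by (simp add: algebra_simps)
  then have "exp y / y \<le> (exp z + (z - 1) * exp y) / z\<^sup>2"
    using assms by (simp add: field_simps)
  then show ?thesis by (simp add: add_divide_distrib)
qed

lemma envelope_le_line:
  assumes "t \<ge> 0"
  shows "envelope t \<le> (exp 2 + t) / 4"
proof (cases "t < exp 2")
  case False
  have "t > 0" using False exp_gt_zero[of 2] by linarith
  then have "ln t \<ge> 2" using False by (simp add: ln_ge_iff)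
  then show ?thesis
    using exp_over_id_le_tangent[of "ln t" 2] False \<open>t > 0\<close> by (simp add: envelope_def field_simps)
qed (simp add: envelope_def)

text \<open>
  To the left of \<open>e\<^sup>2\<close> both sides are linear in \<open>t\<close>, the comparison holds at \<open>e\<^sup>2\<close>, and the slope
  \<open>(ln s - 1) / (ln s)\<^sup>2\<close> is at most \<open>1/4\<close>, the slope of the envelope there.
\<close>

lemma envelope_le_tangent:
  assumes "t \<ge> 0" "s \<ge> exp 2"
  shows "envelope t \<le> s / (ln s)\<^sup>2 + (ln s - 1) / (ln s)\<^sup>2 * t"
proof -
  have s: "s > 0" "ln s \<ge> 2"
    using assms(2) exp_gt_zero[of 2] by (linarith, metis exp_gt_zero ln_exp ln_mono)
  show ?thesis
  proof (cases "t < exp 2")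
    case False
    have "t > 0" using False exp_gt_zero[of 2] by linarith
    then have "ln t \<ge> 2" using False by (simp add: ln_ge_iff)
    then show ?thesis
      using exp_over_id_le_tangent[of "ln t" "ln s"] s False \<open>t > 0\<close> by (simp add: envelope_def)
  next
    case True
    define c where "c = (ln s - 1) / (ln s)\<^sup>2"
    have "c \<le> 1 / 4"
    proof -
      have "0 \<le> (ln s - 2)\<^sup>2" by simp
      then show ?thesis using s by (simp add: c_def field_simps power2_eq_square)
    qed
    then have "c * (exp 2 - t) \<le> 1 / 4 * (exp 2 - t)"
      using True by (intro mult_right_mono) auto
    moreover have "exp 2 / 2 \<le> s / (ln s)\<^sup>2 + c * exp 2"
      using exp_over_id_le_tangent[of 2 "ln s"] s by (simp add: c_def)
    moreover have "envelope t = exp 2 / 2 - 1 / 4 * (exp 2 - t)"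
      using True by (simp add: envelope_def field_simps)
    ultimately show ?thesis unfolding c_def[symmetric] by (simp add: right_diff_distrib)
  qed
qed

lemma envelope_le:
  assumes "t > 1"
  shows "envelope t \<le> t / ln t"
proof (cases "t < exp 2")
  case True
  define y where "y = ln t"
  have t: "t = exp y" using assms by (simp add: y_def)
  have y: "0 < y" "y < 2" using assms True by (simp_all add: t)
  have "exp (2 - y) * (2 - (2 - y)) \<le> 2 + (2 - y)"
    using y by (intro exp_mult_le_Moebius) simp
  then have "exp y * (exp (2 - y) * y) \<le> exp y * (4 - y)"
    by (intro mult_left_mono) auto
  then have "exp 2 * y \<le> exp y * (4 - y)"
    by (simp add: exp_diff)
  then show ?thesis using y by (simp add: envelope_def t field_simps)
qed (simp add: envelope_def)

lemma envelope_pos: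
  assumes "t \<ge> 0"
  shows "envelope t > 0"
proof (cases "t < exp 2")
  case False
  have "t > 0" using False exp_gt_zero[of 2] by linarith
  then have "ln t \<ge> 2" using False by (simp add: ln_ge_iff)
  then have "t / ln t > 0" using \<open>t > 0\<close> divide_pos_pos[of t "ln t"] by linarith
  then show ?thesis using False by (simp add: envelope_def)
next
  case True
  then show ?thesis using assms by (simp add: envelope_def add_pos_nonneg)
qed

section \<open>An upper bound of Wigert type\<close>

lemma multichoose_le_power:
  assumes "k > 0"
  shows "(k + a - 1) choose a \<le> k ^ a"
proof (induction a)
  case (Suc a)
  have "((k + Suc a - 1) choose Suc a) * Suc a = (k + a) * ((k + a - 1) choose a)"
    using Suc_times_binomial_eq[of "k - 1 + a" a] assms by (simp add: ac_simps)
  also have "\<dots> \<le> (k * Suc a) * k ^ a"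
    using Suc assms by (intro mult_mono) auto
  finally have "((k + Suc a - 1) choose Suc a) * Suc a \<le> k ^ Suc a * Suc a"
    by (simp only: power_Suc ac_simps)
  then show ?case by (simp only: mult_le_cancel2)
qed simp

lemma multichoose_le_power_of_exponent:
  assumes "k > 0"
  shows "(k + a - 1) choose a \<le> (a + 1) ^ (k - 1)"
proof -
  have "(l + a) choose a \<le> (a + 1) ^ l" for l
  proof (induction l)
    case (Suc l)
    have "Suc l * ((Suc l + a) choose a) = (Suc l + a) * ((l + a) choose a)"
      using binomial_absorb_comp[of "Suc l + a" a] by simp
    also have "\<dots> \<le> (Suc l * (a + 1)) * (a + 1) ^ l"
      using Suc by (intro mult_mono) auto
    finally have "Suc l * ((Suc l + a) choose a) \<le> Suc l * (a + 1) ^ Suc l"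
      by (simp only: power_Suc mult.assoc)
    then show ?case by (simp only: mult_le_cancel1)
  qed simp
  from this[of "k - 1"] show ?thesis using assms by simp
qed

lemma multichoose_pos: "k > 0 \<Longrightarrow> ((k + a - 1) choose a) > 0"
  by (simp add: zero_less_binomial_iff)

text \<open>
  Primes \<open>p > k\<^bsup>1/\<mu>\<^esup>\<close> satisfy \<open>k \<le> p\<^sup>\<mu>\<close>, so that their part of \<open>d\<^sub>k n / n\<^sup>\<mu>\<close> is at most 1. Each of the at most
  \<open>k\<^bsup>1/\<mu>\<^esup>\<close> remaining primes contributes at most the maximum of \<open>(a + 1)\<^bsup>k-1\<^esup> / 2\<^bsup>\<mu>a\<^esup>\<close> over \<open>a \<ge> 0\<close>.
\<close>

lemma ln_dfact_le:
  fixes \<mu> :: real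
  assumes "k \<ge> 2" "\<mu> > 0" "n > 0"
  shows "ln (real (dfact k n)) \<le> \<mu> * ln (real n) +
      real k powr (1 / \<mu>) * (real (k - 1) * ln (1 + real (k - 1) / (\<mu> * ln 2)))"
proof -
  define x where "x = real k powr (1 / \<mu>)"
  \<comment> \<open>chosen such that \<open>(k - 1) a / c = \<mu> a ln 2\<close>\<close>
  define c where "c = real (k - 1) / (\<mu> * ln 2)"
  define M where "M = real (k - 1) * ln (1 + c)"
  have c: "c > 0" unfolding c_def using assms by (intro divide_pos_pos mult_pos_pos) auto
  have M: "M \<ge> 0" unfolding M_def using c by simp
  have x: "x \<ge> 0" by (simp add: x_def)
  define g where "g p = ln (real ((k + multiplicity p n - 1) choose multiplicity p n))
      - \<mu> * (real (multiplicity p n) * ln (real p))" for p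
  have g1: "g p \<le> M" if "p \<in> prime_factors n" for p
  proof -
    define a where "a = multiplicity p n"
    have p: "p \<ge> 2" using that prime_ge_2_nat by auto
    have "ln (real ((k + a - 1) choose a)) \<le> ln (real ((a + 1) ^ (k - 1)))"
      using multichoose_le_power_of_exponent[of k a] multichoose_pos[of k a] assms(1)
      by (subst ln_le_cancel_iff) (simp_all del: of_nat_power add: of_nat_le_iff)
    also have "\<dots> = real (k - 1) * ln (1 + real a)"
      by (simp add: ln_realpow)
    also have "ln (1 + real a) \<le> ln (1 + c) + real a / c"
    proof -
      have "1 + real a \<le> (1 + c) * exp (real a / c)"
      proof -
        have "1 + real a \<le> (1 + c) * (1 + real a / c)"
          using c by (simp add: field_simps)
        also have "\<dots> \<le> (1 + c) * exp (real a / c)"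
          using c by (intro mult_left_mono exp_ge_add_one_self) auto
        finally show ?thesis .
      qed
      then have "ln (1 + real a) \<le> ln ((1 + c) * exp (real a / c))"
        using c by (subst ln_le_cancel_iff) auto
      also have "\<dots> = ln (1 + c) + real a / c"
        using c by (subst ln_mult) auto
      finally show ?thesis .
    qed
    also have "real (k - 1) * (ln (1 + c) + real a / c) = M + \<mu> * (real a * ln 2)"
      using assms(1,2) by (simp add: M_def c_def field_simps)
    also have "\<dots> \<le> M + \<mu> * (real a * ln (real p))"
      using p assms by (intro add_left_mono mult_left_mono) auto
    finally show ?thesis unfolding g_def a_def by (simp add: mult_left_mono)
  qed
  have g2: "g p \<le> 0" if "p \<in> prime_factors n" "real p > x" for p
  proof -
    define a where "a = multiplicity p n"
    have p: "p \<ge> 2" using that prime_ge_2_nat by auto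
    have "ln (real k) / \<mu> \<le> ln (real p)"
      using ln_mono[of x "real p"] that(2) assms p by (simp add: x_def ln_powr)
    then have *: "ln (real k) \<le> \<mu> * ln (real p)"
      using assms by (simp add: field_simps)
    have "ln (real ((k + a - 1) choose a)) \<le> ln (real (k ^ a))"
      using multichoose_le_power[of k a] multichoose_pos[of k a] assms(1)
      by (subst ln_le_cancel_iff) (simp_all del: of_nat_power add: of_nat_le_iff)
    also have "\<dots> = real a * ln (real k)"
      by (simp add: ln_realpow)
    also have "\<dots> \<le> real a * (\<mu> * ln (real p))"
      using * by (intro mult_left_mono) auto
    finally show ?thesis unfolding g_def a_def by (simp add: ac_simps)
  qed
  have "ln (real (dfact k n)) - \<mu> * ln (real n) = (\<Sum>p\<in>prime_factors n. g p)"
    using ln_dfact[of n k] ln_eq_sum_prime_factors[of n] assms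
    by (simp add: g_def sum_subtractf sum_distrib_left)
  also have "\<dots> \<le> (\<Sum>p\<in>prime_factors n. if real p \<le> x then M else 0)"
    using g1 g2 by (intro sum_mono) (auto simp: not_le)
  also have "\<dots> = real (card {p \<in> prime_factors n. real p \<le> x}) * M"
    by (simp flip: sum.inter_filter)
  also have "\<dots> \<le> x * M"
  proof (intro mult_right_mono M)
    have "{p \<in> prime_factors n. real p \<le> x} \<subseteq> {1..nat \<lfloor>x\<rfloor>}"
      by (auto simp: le_nat_floor Suc_le_eq prime_factors_gt_0_nat)
    then have "card {p \<in> prime_factors n. real p \<le> x} \<le> nat \<lfloor>x\<rfloor>"
      using card_mono[of "{1..nat \<lfloor>x\<rfloor>}"] by fastforce
    then show "real (card {p \<in> prime_factors n. real p \<le> x}) \<le> x"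
      using x by linarith
  qed
  finally show ?thesis unfolding x_def M_def c_def by simp
qed

text \<open>
  The choice \<open>\<mu> = 10/9 K / ln (ln n)\<close> makes \<open>k\<^bsup>1/\<mu>\<^esup> = (ln n)\<^bsup>9/10\<^esup>\<close>, which is negligible against
  \<open>ln n / ln (ln n)\<close>. The same argument works with any constant above 1 in place of \<open>6/5\<close>; this one is
  below the value of the quotient at \<open>n = 210\<close>.
\<close>

lemma Wigert_bound:
  assumes "k \<ge> 2"
  shows "eventually (\<lambda>n. ln (real (dfact k n)) \<le> 6 / 5 * ln (real k) * (ln (real n) / ln (ln (real n)))) at_top"
proof -
  define K where "K = ln (real k)"
  have K: "K > 0" using assms by (simp add: K_def)
  define A where "A = real (k - 1)"
  have A: "A > 0" using assms by (simp add: A_def)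
  define B where "B = A * (9 / 10) / (K * ln 2)"
  have B: "B > 0" unfolding B_def using A K by simp
  have "eventually (\<lambda>t. t powr (9 / 10) * (A * ln (1 + B * ln t)) \<le> K / 12 * (t / ln t)) at_top"
    using A B K by real_asymp
  moreover have "filterlim (\<lambda>n. ln (real n)) at_top at_top"
    by real_asymp
  ultimately have *: "eventually (\<lambda>n. ln (real n) powr (9 / 10) * (A * ln (1 + B * ln (ln (real n))))
      \<le> K / 12 * (ln (real n) / ln (ln (real n)))) at_top"
    by (rule eventually_compose_filterlim)
  have "eventually (\<lambda>n::nat. ln (ln (real n)) > 0) at_top"
    by real_asymp
  with * eventually_gt_at_top[of 1] show ?thesis
  proof eventually_elim
    case (elim n)
    define t where "t = ln (real n)"
    define L where "L = ln t"
    define \<mu> where "\<mu> = K * (10 / 9) / L"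
    have L: "L > 0" using elim by (simp add: L_def t_def)
    have t: "t > 0" using elim by (simp add: t_def)
    have \<mu>: "\<mu> > 0" using L K by (simp add: \<mu>_def)
    have "real k powr (1 / \<mu>) = exp (L * (9 / 10))"
      using assms K L unfolding powr_def \<mu>_def K_def[symmetric] by simp
    also have "\<dots> = t powr (9 / 10)" using t by (simp add: powr_def L_def)
    finally have x: "real k powr (1 / \<mu>) = t powr (9 / 10)" .
    have y: "A / (\<mu> * ln 2) = B * L"
      using L K by (simp add: B_def \<mu>_def field_simps)
    have "ln (real (dfact k n)) \<le> \<mu> * t + t powr (9 / 10) * (A * ln (1 + B * L))"
      using ln_dfact_le[OF assms \<mu>, of n] elim(2) unfolding x y t_def[symmetric] A_def[symmetric] by (simp del: One_nat_def)
    also have "\<dots> \<le> \<mu> * t + K / 12 * (t / L)"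
      using elim(1) by (simp add: t_def L_def)
    also have "\<dots> = (10 / 9 + 1 / 12) * (K * (t / L))"
      by (simp add: \<mu>_def field_simps)
    also have "\<dots> \<le> 6 / 5 * (K * (t / L))"
      using K t L by (intro mult_right_mono) auto
    finally show ?case by (simp add: K_def t_def L_def)
  qed
qed

section \<open>Existence of a maximizer\<close>

text \<open>
  The number 210 is the witness that the supremum exceeds the limit superior: for a squarefree \<open>n\<close> with
  \<open>r\<close> prime factors the quotient \<open>fratio k n\<close> is \<open>r ln (ln n) / ln n\<close>, independently of \<open>k\<close>.
\<close>

lemma dfact_210: "dfact k 210 = k ^ 4"
proof -
  have "dfact k (2 ^ 1 * 105) = k * dfact k 105" by (subst dfact_prime_power_mult) auto
  moreover have "dfact k (3 ^ 1 * 35) = k * dfact k 35" by (subst dfact_prime_power_mult) auto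
  moreover have "dfact k (5 ^ 1 * 7) = k * dfact k 7" by (subst dfact_prime_power_mult) auto
  moreover have "dfact k (7 ^ 1 * 1) = k * dfact k 1" by (subst dfact_prime_power_mult) auto
  ultimately show ?thesis by (simp add: dfact_1[unfolded One_nat_def] power4_eq_xxxx)
qed

lemma exists_maximizer:
  assumes "k \<ge> 2"
  shows "\<exists>lam N. lam > 0 \<and> N > 0 \<and>
    ln (real (dfact k N)) = lam * ln (real k) * envelope (ln (real N)) \<and>
    (\<forall>n>0. ln (real (dfact k n)) \<le> lam * ln (real k) * envelope (ln (real n)))"
proof -
  define K where "K = ln (real k)"
  have K: "K > 0" using assms by (simp add: K_def)
  define r where "r n = ln (real (dfact k n)) / (K * envelope (ln (real n)))" for n
  have r210: "r 210 \<ge> 6 / 5"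
  proof -
    have "(2.718::real) ^ 5 * 1.48 \<le> exp 1 ^ 5 * exp (4 / 10)"
      using exp_1_ge exp_lower_Taylor_quadratic[of "4 / 10"]
      by (intro mult_mono power_mono) (auto simp: power2_eq_square)
    also have "\<dots> = exp (5.4::real)"
      by (simp flip: exp_of_nat_mult exp_add)
    finally have "210 \<le> exp (5.4::real)" by (simp add: power_divide)
    then have l: "ln (210::real) \<le> 5.4" using ln_mono[of 210 "exp 5.4"] by simp
    have "envelope (ln 210) \<le> (exp 2 + ln 210) / 4"
      by (intro envelope_le_line) simp
    also have "\<dots> \<le> 10 / 3" using l exp_2_le by simp
    finally have "K * envelope (ln 210) * (6 / 5) \<le> K * (10 / 3) * (6 / 5)"
      using K by (intro mult_right_mono mult_left_mono) auto
    moreover have "r 210 = 4 * K / (K * envelope (ln 210))"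
      by (simp add: r_def dfact_210 K_def ln_realpow)
    moreover have "K * envelope (ln 210) > 0"
      using K by (intro mult_pos_pos envelope_pos) simp_all
    ultimately show ?thesis
      using pos_le_divide_eq[of "K * envelope (ln 210)" "6 / 5" "4 * K"] by (simp only: mult.commute)
  qed
  have "eventually (\<lambda>n. ln (real n) \<ge> exp 2) at_top"
    by real_asymp
  with Wigert_bound[OF assms] have "eventually (\<lambda>n. r n \<le> 6 / 5) at_top"
  proof eventually_elim
    case (elim n)
    have "K * envelope (ln (real n)) > 0"
      using K elim exp_gt_zero[of 2] by (intro mult_pos_pos envelope_pos) linarith+
    moreover have "envelope (ln (real n)) = ln (real n) / ln (ln (real n))"
      using elim by (simp add: envelope_def)
    then have "ln (real (dfact k n)) \<le> 6 / 5 * (K * envelope (ln (real n)))"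
      using elim by (simp add: K_def mult.assoc)
    ultimately show ?case unfolding r_def
      by (simp only: pos_divide_le_eq)
  qed
  then obtain n\<^sub>0 where n0: "\<And>n. n \<ge> n\<^sub>0 \<Longrightarrow> r n \<le> 6 / 5"
    by (auto simp: eventually_at_top_linorder)
  define S where "S = {1..max n\<^sub>0 210}"
  have S: "finite S" "210 \<in> S" by (auto simp: S_def)
  have "Max (r ` S) \<in> r ` S" using S by (intro Max_in) auto
  then obtain N where "N \<in> S" "r N = Max (r ` S)" by auto
  then have N: "N \<in> S" "\<And>n. n \<in> S \<Longrightarrow> r n \<le> r N"
    using S by simp_all
  have "r n \<le> r N" if "n > 0" for n
  proof (cases "n \<in> S")
    case False
    then have "r n \<le> 6 / 5" using that by (intro n0) (auto simp: S_def)
    also have "\<dots> \<le> r 210" by (rule r210)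
    also have "\<dots> \<le> r N" using N S by blast
    finally show ?thesis .
  qed (rule N)
  note max = this
  have pos: "K * envelope (ln (real n)) > 0" if "n > 0" for n
    using K that by (intro mult_pos_pos envelope_pos) simp_all
  have "N > 0" using N by (auto simp: S_def)
  moreover have "r N > 0" using max[of 210] r210 by simp
  moreover have "ln (real (dfact k N)) = r N * K * envelope (ln (real N))"
    using pos[OF \<open>N > 0\<close>] r_def[of N] nonzero_eq_divide_eq by (metis mult.assoc less_irrefl)
  moreover have "ln (real (dfact k n)) \<le> r N * K * envelope (ln (real n))" if "n > 0" for n
    using max[OF that] pos[OF that] unfolding r_def[of n] by (simp only: pos_divide_le_eq mult.assoc)
  ultimately show ?thesis unfolding K_def by blast
qed

section \<open>Exponents of superior highly composite numbers\<close>

lemma dfact_pos: "n > 0 \<Longrightarrow> k > 0 \<Longrightarrow> dfact k n > 0"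
  using ln_dfact by blast

lemma superior_highly_composite_iff_ln:
  assumes "k > 0" "\<mu> > 0" "N > 0"
  shows "superior_highly_composite k \<mu> N \<longleftrightarrow>
    (\<forall>n>0. ln (real (dfact k n)) - \<mu> * ln (real n) \<le> ln (real (dfact k N)) - \<mu> * ln (real N))"
proof -
  have "real (dfact k n) / real n powr \<mu> = exp (ln (real (dfact k n)) - \<mu> * ln (real n))" if "n > 0" for n
    using dfact_pos[OF that assms(1)] that by (simp add: exp_diff powr_def)
  then show ?thesis
    using assms unfolding superior_highly_composite_def by auto
qed

text \<open>
  Comparing \<open>N\<close> with \<open>p N\<close> bounds the exponent of \<open>p\<close> from below.
\<close>

lemma superior_exponent_lower:
  assumes "superior_highly_composite k \<mu> N" "k > 0" "prime p"
  shows "(real k + real (multiplicity p N)) / (real (multiplicity p N) + 1) \<le> real p powr \<mu>"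
proof -
  define a where "a = multiplicity p N"
  have N: "N > 0" using assms(1) by (simp add: superior_highly_composite_def)
  have p: "p > 0" using assms(3) by (rule prime_gt_0_nat)
  define d where "d = real (dfact k N)"
  have d: "d > 0" using dfact_pos[OF N assms(2)] by (simp add: d_def)
  have "real (dfact k (p * N) * (a + 1)) = real ((k + a) * dfact k N)"
    unfolding a_def by (subst dfact_prime_mult[OF assms(3) N assms(2)]) (rule refl)
  then have *: "real (dfact k (p * N)) = (real k + real a) / (real a + 1) * d"
    by (simp add: d_def field_simps)
  have "p * N > 0" using N p by simp
  then have "real (dfact k (p * N)) / real (p * N) powr \<mu> \<le> d / real N powr \<mu>"
    using assms(1) unfolding superior_highly_composite_def d_def by blast
  then have "((real k + real a) / (real a + 1) * d) / (real p powr \<mu> * real N powr \<mu>) \<le> d / real N powr \<mu>"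
    by (simp only: * of_nat_mult powr_mult)
  then have "(real k + real a) / (real a + 1) / real p powr \<mu> * (d / real N powr \<mu>) \<le> 1 * (d / real N powr \<mu>)"
    by (simp add: field_simps)
  then have "(real k + real a) / (real a + 1) / real p powr \<mu> \<le> 1"
    using d N by (subst (asm) mult_le_cancel_right) (simp add: not_less)
  then show ?thesis
    using p unfolding a_def[symmetric] by (simp add: divide_le_eq mult.commute)
qed

text \<open>
  Comparing \<open>N\<close> with \<open>N / p\<close> bounds the exponent of \<open>p\<close> from above.
\<close>

lemma superior_exponent_upper:
  assumes "superior_highly_composite k \<mu> N" "k > 0" "prime p" "multiplicity p N > 0"
  shows "real p powr \<mu> \<le> (real k + real (multiplicity p N) - 1) / real (multiplicity p N)"
proof -
  have N: "N > 0" using assms(1) by (simp add: superior_highly_composite_def)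
  have p: "p > 0" using assms(3) by (rule prime_gt_0_nat)
  have "p dvd N" using assms(4) not_dvd_imp_multiplicity_0 by force
  then obtain M where M: "N = p * M" by (rule dvdE)
  have "M > 0" using M N by simp
  define a where "a = multiplicity p M"
  have aN: "multiplicity p N = Suc a"
    unfolding a_def M using assms(3) \<open>M > 0\<close>
    by (subst multiplicity_times_same) auto
  define d where "d = real (dfact k M)"
  have d: "d > 0" using dfact_pos[OF \<open>M > 0\<close> assms(2)] by (simp add: d_def)
  have "real (dfact k N * (a + 1)) = real ((k + a) * dfact k M)"
    unfolding a_def M by (subst dfact_prime_mult[OF assms(3) \<open>M > 0\<close> assms(2)]) (rule refl)
  then have *: "real (dfact k N) = (real k + real a) / (real a + 1) * d"
    by (simp add: d_def field_simps)
  have "d / real M powr \<mu> \<le> real (dfact k N) / real N powr \<mu>"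
    using assms(1) \<open>M > 0\<close> unfolding superior_highly_composite_def d_def by simp
  then have "d / real M powr \<mu> \<le> ((real k + real a) / (real a + 1) * d) / (real p powr \<mu> * real M powr \<mu>)"
    unfolding * unfolding M by (simp only: of_nat_mult powr_mult)
  then have "1 * (d / real M powr \<mu>) \<le> (real k + real a) / (real a + 1) / real p powr \<mu> * (d / real M powr \<mu>)"
    by (simp add: field_simps)
  then have "1 \<le> (real k + real a) / (real a + 1) / real p powr \<mu>"
    using d \<open>M > 0\<close> by (subst (asm) mult_le_cancel_right) (simp add: not_less)
  then show ?thesis
    using p unfolding aN by (simp add: le_divide_eq add.commute mult.commute)
qed

lemma superior_exponent_antimono:
  assumes "superior_highly_composite k \<mu> N" "k \<ge> 2" "prime p" "prime q" "p < q"
  shows "multiplicity q N \<le> multiplicity p N"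
proof (rule ccontr)
  define a b where "a = multiplicity p N" and "b = multiplicity q N"
  assume "\<not> multiplicity q N \<le> multiplicity p N"
  then have ab: "a + 1 \<le> b" by (simp add: a_def b_def)
  have mu: "\<mu> > 0" using assms(1) by (simp add: superior_highly_composite_def)
  have "1 + (real k - 1) / (real a + 1) \<le> real p powr \<mu>"
    using superior_exponent_lower[OF assms(1) _ assms(3)] assms(2) unfolding a_def[symmetric]
    by (simp add: field_simps)
  also have "\<dots> < real q powr \<mu>"
    using assms(3,5) mu by (intro powr_less_mono2) auto
  also have "\<dots> \<le> 1 + (real k - 1) / real b"
    using superior_exponent_upper[OF assms(1) _ assms(4)] assms(2) ab unfolding b_def[symmetric]
    by (simp add: field_simps)
  also have "\<dots> \<le> 1 + (real k - 1) / (real a + 1)"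
    using ab assms(2) by (intro add_left_mono divide_left_mono) auto
  finally show False by simp
qed

section \<open>Small superior highly composite numbers\<close>

text \<open>
  When \<open>k\<close> increases by 1, the left side grows by the factor \<open>(k+a)/k\<close> and the right side, by
  Bernoulli's inequality, at least by \<open>1 + 2a/(k+a)\<close>, which is larger for \<open>k \<ge> a\<close>. This leaves \<open>k = a\<close>
  and the additional cases \<open>k = a - 1\<close>. For \<open>a \<le> 10\<close> and \<open>k \<ge> 2\<close> the inequality fails outside the stated
  range, for instance for \<open>(k, a) = (2, 3)\<close> and \<open>(3, 4)\<close>.
\<close>

lemma multichoose_le_square_power:
  fixes k a :: nat
  assumes "a \<le> 10" "a \<le> k \<or> a = k + 1 \<and> k \<ge> 4"
  shows "((k + a - 1) choose a) * (a + 1) ^ (2 * a) \<le> (k + a) ^ (2 * a)"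
proof (cases "a \<le> k")
  case True
  then show ?thesis
  proof (induction k rule: dec_induct)
    case base
    have "a = 0 \<or> a = 1 \<or> a = 2 \<or> a = 3 \<or> a = 4 \<or> a = 5 \<or> a = 6 \<or> a = 7 \<or> a = 8 \<or> a = 9 \<or> a = 10"
      using assms(1) by presburger
    then show ?case
      by (elim disjE) (simp_all add: binomial_fact' fact_numeral)
  next
    case (step k)
    show ?case
    proof (cases "a = 0")
      case False
      then have "k > 0" using step by simp
      have abs: "((Suc k + a - 1) choose a) * k = (k + a) * ((k + a - 1) choose a)"
        using binomial_absorb_comp[of "k + a" a] by (simp add: mult.commute)
      have "1 + real (2 * a) * (1 / real (k + a)) \<le> (1 + 1 / real (k + a)) ^ (2 * a)"
        by (rule Bernoulli_inequality, rule order_trans[of _ 0]) simp_all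
      moreover have "real (k + a) / real k \<le> 1 + real (2 * a) * (1 / real (k + a))"
      proof -
        have "(real k + real a) * (real k + real a) \<le> real k * (real k + real a + 2 * real a)"
        proof -
          have "real a * real a \<le> real a * real k" using step by (intro mult_left_mono) auto
          then show ?thesis by (simp add: algebra_simps)
        qed
        then show ?thesis using \<open>k > 0\<close> by (simp add: field_simps)
      qed
      moreover have "1 + 1 / real (k + a) = real (Suc k + a) / real (k + a)"
        using \<open>k > 0\<close> by (simp add: field_simps)
      ultimately have "real (k + a) / real k \<le> real (Suc k + a) ^ (2 * a) / real (k + a) ^ (2 * a)"
        by (simp only: power_divide)
      then have "real ((k + a) * (k + a) ^ (2 * a)) \<le> real (k * (Suc k + a) ^ (2 * a))"
        using \<open>k > 0\<close> by (simp add: field_simps)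
      then have r: "(k + a) * (k + a) ^ (2 * a) \<le> k * (Suc k + a) ^ (2 * a)"
        by (simp only: of_nat_le_iff)
      have "k * (((Suc k + a - 1) choose a) * (a + 1) ^ (2 * a)) =
          (k + a) * (((k + a - 1) choose a) * (a + 1) ^ (2 * a))"
        using abs by (metis mult.assoc mult.commute)
      also have "\<dots> \<le> (k + a) * (k + a) ^ (2 * a)"
        using step.IH by (rule mult_left_mono) simp
      also have "\<dots> \<le> k * (Suc k + a) ^ (2 * a)" by (rule r)
      finally show ?thesis using \<open>k > 0\<close> by (simp only: mult_le_cancel1)
    qed simp
  qed
next
  case False
  then have "k = 4 \<or> k = 5 \<or> k = 6 \<or> k = 7 \<or> k = 8 \<or> k = 9" "a = k + 1"
    using assms by presburger+
  then show ?thesis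
    by (elim disjE) (simp_all add: binomial_fact' fact_numeral)
qed

lemma powr_power_le:
  fixes p q i j :: nat and \<mu> :: real
  assumes "p ^ i \<le> q ^ j" "\<mu> \<ge> 0" "p > 0" "q > 0"
  shows "(real p powr \<mu>) ^ i \<le> (real q powr \<mu>) ^ j"
proof -
  have "(real (p ^ i)) powr \<mu> \<le> (real (q ^ j)) powr \<mu>"
    using assms by (intro powr_mono2) (auto simp del: of_nat_power)
  then show ?thesis
    using assms by (simp add: powr_powr powr_power mult.commute flip: powr_realpow)
qed

text \<open>
  Since \<open>(k+a)/(a+1) \<le> p\<^sup>\<mu>\<close>, the preceding inequality bounds the factor of \<open>d\<^sub>k N\<close> at \<open>p\<close> by \<open>p\<^bsup>2\<mu>a\<^esup>\<close>.
\<close>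

lemma ln_multichoose_le:
  assumes "superior_highly_composite k \<mu> N" "k \<ge> 2" "prime p"
    and "((k + a - 1) choose a) * (a + 1) ^ (2 * a) \<le> (k + a) ^ (2 * a)" "a = multiplicity p N"
  shows "ln (real ((k + a - 1) choose a)) \<le> 2 * \<mu> * (real a * ln (real p))"
proof -
  have p: "p > 0" using assms(3) by (rule prime_gt_0_nat)
  have c: "real ((k + a - 1) choose a) > 0" using assms(2) by (simp add: zero_less_binomial_iff)
  have "real ((k + a - 1) choose a) * (real a + 1) ^ (2 * a) \<le> (real k + real a) ^ (2 * a)"
    using of_nat_mono[OF assms(4), where ?'a = real] by (simp add: add.commute)
  then have "real ((k + a - 1) choose a) \<le> ((real k + real a) / (real a + 1)) ^ (2 * a)"
    by (simp add: power_divide le_divide_eq)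
  also have "\<dots> \<le> (real p powr \<mu>) ^ (2 * a)"
    using superior_exponent_lower[OF assms(1) _ assms(3)] assms(2,5) by (intro power_mono) auto
  finally have "ln (real ((k + a - 1) choose a)) \<le> ln ((real p powr \<mu>) ^ (2 * a))"
    using c by (rule ln_mono)
  also have "\<dots> = 2 * \<mu> * (real a * ln (real p))"
    using p by (simp add: ln_realpow ln_powr)
  finally show ?thesis .
qed

lemma prime_power_product_le:
  fixes N :: nat
  assumes "N > 0" "b \<le> multiplicity 3 N" "c \<le> multiplicity 5 N" "d \<le> multiplicity 7 N" "a \<le> multiplicity 2 N"
  shows "2 ^ a * 3 ^ b * 5 ^ c * 7 ^ d \<le> N"
proof -
  have co: "coprime (2 ^ a) (3 ^ b :: nat)" "coprime (2 ^ a * 3 ^ b) (5 ^ c :: nat)"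
      "coprime (2 ^ a * 3 ^ b * 5 ^ c) (7 ^ d :: nat)"
    by (simp_all add: primes_coprime)
  have "2 ^ a dvd N" "3 ^ b dvd N" "5 ^ c dvd N" "7 ^ d dvd N"
    using assms by (auto intro: multiplicity_dvd')
  then have "2 ^ a * 3 ^ b * 5 ^ c * 7 ^ d dvd N"
    using co by (intro divides_mult)
  then show ?thesis using assms(1) by (rule dvd_imp_le)
qed

text \<open>
  The bound 1728 is a convenient number above \<open>exp (e\<^sup>2) \<approx> 1618\<close>. It limits the exponents of \<open>N\<close> so much
  that the few pairs \<open>(k, a)\<close> outside the range of \<open>multichoose_le_square_power\<close> can be discussed one by
  one. The tools are the bounds for \<open>p\<^sup>\<mu>\<close> in terms of the exponents, and comparisons such as \<open>3\<^sup>5 \<le> 2\<^sup>8\<close>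
  that transfer them from one prime to another.
\<close>

locale small_superior =
  fixes k :: nat and \<mu> :: real and N :: nat
  assumes k: "k \<ge> 2" and sup: "superior_highly_composite k \<mu> N" and N_less: "N < 1728"
begin

abbreviation "a \<equiv> multiplicity 2 N"
abbreviation "b \<equiv> multiplicity 3 N"

lemma N_pos: "N > 0" and mu_pos: "\<mu> > 0"
  using sup by (simp_all add: superior_highly_composite_def)

lemma product_less:
  assumes "i \<le> a" "j \<le> b" "c \<le> multiplicity 5 N" "d \<le> multiplicity 7 N"
  shows "2 ^ i * 3 ^ j * 5 ^ c * 7 ^ d < (1728 :: nat)"
  using prime_power_product_le[OF N_pos assms(2,3,4,1)] N_less by linarith

lemma lower_powr: "prime p \<Longrightarrow> multiplicity p N \<le> m \<Longrightarrow> 1 + (real k - 1) / (real m + 1) \<le> real p powr \<mu>"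
proof -
  assume p: "prime p" "multiplicity p N \<le> m"
  have "1 + (real k - 1) / (real m + 1) \<le> 1 + (real k - 1) / (real (multiplicity p N) + 1)"
    using k p by (intro add_left_mono divide_left_mono) auto
  also have "\<dots> = (real k + real (multiplicity p N)) / (real (multiplicity p N) + 1)"
    by (simp add: field_simps)
  also have "\<dots> \<le> real p powr \<mu>"
    using k by (intro superior_exponent_lower[OF sup _ p(1)]) auto
  finally show ?thesis .
qed

lemma upper_powr: "prime p \<Longrightarrow> m \<le> multiplicity p N \<Longrightarrow> m > 0 \<Longrightarrow> real p powr \<mu> \<le> 1 + (real k - 1) / real m"
proof -
  assume p: "prime p" "m \<le> multiplicity p N" "m > 0"
  have "real p powr \<mu> \<le> (real k + real (multiplicity p N) - 1) / real (multiplicity p N)"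
    using k p by (intro superior_exponent_upper[OF sup _ p(1)]) auto
  also have "\<dots> = 1 + (real k - 1) / real (multiplicity p N)"
    using p by (simp add: field_simps)
  also have "\<dots> \<le> 1 + (real k - 1) / real m"
    using k p by (intro add_left_mono divide_left_mono) auto
  finally show ?thesis .
qed

lemma powr_3: "(3 powr \<mu>) ^ 5 \<le> (2 powr \<mu>) ^ 8"
  using powr_power_le[of 3 5 2 8 \<mu>] mu_pos by simp

lemma powr_7: "7 powr \<mu> \<le> (2 powr \<mu>) ^ 3"
  using powr_power_le[of 7 1 2 3 \<mu>] mu_pos by simp

lemma powr_5: "5 powr \<mu> \<le> 7 powr \<mu>"
  using mu_pos by (intro powr_mono2) auto

lemma exponent_3_le_exponent_2: "b \<le> a"
  by (rule superior_exponent_antimono[OF sup k]) auto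

lemma exponent_2_small: "a \<le> 10"
proof (rule ccontr)
  assume "\<not> a \<le> 10"
  then show False using product_less[of 11 0 0 0] by simp
qed

text \<open>
  An exponent \<open>a \<ge> m\<close> of 2 gives \<open>2\<^sup>\<mu> \<le> 1 + (k-1)/m\<close>, hence an upper bound for \<open>3\<^sup>\<mu>\<close>; an exponent of 3 that
  is at most \<open>j\<close> would give a lower bound for \<open>3\<^sup>\<mu>\<close> that contradicts it.
\<close>

lemma exponent_3_gt:
  assumes "m > 0" "m \<le> a" "(1 + (real k - 1) / real m) ^ 8 < (1 + (real k - 1) / (real j + 1)) ^ 5"
  shows "j < b"
proof (rule ccontr)
  assume "\<not> j < b"
  then have "1 + (real k - 1) / (real j + 1) \<le> 3 powr \<mu>" using lower_powr[of 3 j] by simp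
  then have "(1 + (real k - 1) / (real j + 1)) ^ 5 \<le> (3 powr \<mu>) ^ 5"
    using k by (intro power_mono) auto
  also have "\<dots> \<le> (2 powr \<mu>) ^ 8" by (rule powr_3)
  also have "\<dots> \<le> (1 + (real k - 1) / real m) ^ 8"
    using upper_powr[of 2 m] assms(1,2) by (intro power_mono) auto
  finally show False using assms(3) by simp
qed

text \<open>
  If 5 or 7 did not divide \<open>N\<close>, then \<open>k \<le> 5\<^sup>\<mu> \<le> 7\<^sup>\<mu> \<le> 2\<^bsup>3\<mu>\<^esup>\<close> or \<open>k \<le> 7\<^sup>\<mu> \<le> 2\<^bsup>3\<mu>\<^esup>\<close>,
  whereas the exponent of 2 keeps \<open>2\<^sup>\<mu>\<close> small.
\<close>

lemma exponents_5_7_pos: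
  assumes "m > 0" "m \<le> a" "(1 + (real k - 1) / real m) ^ 3 < real k"
  shows "1 \<le> multiplicity 5 N" "1 \<le> multiplicity 7 N"
proof -
  have "7 powr \<mu> \<le> (2 powr \<mu>) ^ 3" by (rule powr_7)
  also have "\<dots> \<le> (1 + (real k - 1) / real m) ^ 3"
    using upper_powr[of 2 m] assms(1,2) by (intro power_mono) auto
  finally have 7: "7 powr \<mu> < real k" using assms(3) by simp
  with powr_5 have 5: "5 powr \<mu> < real k" by simp
  show "1 \<le> multiplicity 5 N" using lower_powr[of 5 0] 5 by (cases "multiplicity 5 N = 0") auto
  show "1 \<le> multiplicity 7 N" using lower_powr[of 7 0] 7 by (cases "multiplicity 7 N = 0") auto
qed

text \<open>
  A large exponent of 2 makes \<open>2\<^sup>\<mu>\<close> small, which forces factors 3, and for \<open>k \<le> 3\<close> also the factors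
  5 and 7. The product is then too large.
\<close>

lemma exponent_2_le: "a \<le> k + 1"
proof (rule ccontr)
  assume "\<not> a \<le> k + 1"
  then have ak: "k + 2 \<le> a" by simp
  then have "k \<le> 8" using exponent_2_small by simp
  then consider "k = 2" | "k = 3" | "k = 4" | "k = 5" | "k = 6" | "k = 7" | "k = 8"
    using k by linarith
  then show False
  proof cases
    case 1
    have "1 < b" by (rule exponent_3_gt[of 4]) (use 1 ak in \<open>simp_all add: power_divide\<close>)
    moreover have "1 \<le> multiplicity 5 N" "1 \<le> multiplicity 7 N"
      by (rule exponents_5_7_pos[of 4]; use 1 ak in \<open>simp add: power_divide\<close>)+
    ultimately show False using product_less[of 4 2 1 1] 1 ak by simp
  next
    case 2
    have "1 < b" by (rule exponent_3_gt[of 5]) (use 2 ak in \<open>simp_all add: power_divide\<close>)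
    moreover have "1 \<le> multiplicity 5 N" "1 \<le> multiplicity 7 N"
      by (rule exponents_5_7_pos[of 5]; use 2 ak in \<open>simp add: power_divide\<close>)+
    ultimately show False using product_less[of 5 2 1 1] 2 ak by simp
  next
    case 3
    have "2 < b" by (rule exponent_3_gt[of 6]) (use 3 ak in \<open>simp_all add: power_divide\<close>)
    then show False using product_less[of 6 3 0 0] 3 ak by simp
  next
    case 4
    have "2 < b" by (rule exponent_3_gt[of 7]) (use 4 ak in \<open>simp_all add: power_divide\<close>)
    then show False using product_less[of 7 3 0 0] 4 ak by simp
  next
    case 5
    have "1 < b" by (rule exponent_3_gt[of 8]) (use 5 ak in \<open>simp_all add: power_divide\<close>)
    then show False using product_less[of 8 2 0 0] 5 ak by simp
  next
    case 6
    have "1 < b" by (rule exponent_3_gt[of 9]) (use 6 ak in \<open>simp_all add: power_divide\<close>)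
    then show False using product_less[of 9 2 0 0] 6 ak by simp
  next
    case 7
    have "0 < b" by (rule exponent_3_gt[of 10]) (use 7 ak in \<open>simp_all add: power_divide\<close>)
    then show False using product_less[of 10 1 0 0] 7 ak by simp
  qed
qed

text \<open>
  The exponent of 3 is bounded above because \<open>2\<^sup>3 \<le> 3\<^sup>2\<close>: a large exponent of 3 would make \<open>3\<^sup>\<mu>\<close>, hence
  \<open>2\<^sup>\<mu>\<close>, so small that the exponent of 2 exceeded \<open>k + 1\<close>.
\<close>

lemma exponents_of_exceptions:
  assumes "a = k + 1" "k < 4"
  shows "k = 2 \<and> a = 3 \<and> b \<in> {1, 2} \<or> k = 3 \<and> a = 4 \<and> b \<in> {2, 3}"
proof -
  have "k = 2 \<or> k = 3" using k assms by auto
  then show ?thesis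
  proof
    assume k2: "k = 2"
    have "0 < b" by (rule exponent_3_gt[of 3]) (use k2 assms in \<open>simp_all add: power_divide\<close>)
    moreover have "b < 3"
    proof (rule ccontr)
      assume "\<not> b < 3"
      then have "3 powr \<mu> \<le> 4 / 3" using upper_powr[of 3 3] k2 by simp
      then have "(3 powr \<mu>) ^ 2 \<le> (4 / 3) ^ 2" by (intro power_mono) auto
      moreover have "5 / 4 \<le> 2 powr \<mu>" using lower_powr[of 2 3] k2 assms by simp
      then have "(5 / 4) ^ 3 \<le> (2 powr \<mu>) ^ 3" by (intro power_mono) auto
      moreover have "(2 powr \<mu>) ^ 3 \<le> (3 powr \<mu>) ^ 2"
        using powr_power_le[of 2 3 3 2 \<mu>] mu_pos by simp
      ultimately have "(5 / 4) ^ 3 \<le> (4 / 3 :: real) ^ 2" by linarith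
      then show False by (simp add: power_divide)
    qed
    ultimately show ?thesis using k2 assms by auto
  next
    assume k3: "k = 3"
    have "1 < b" by (rule exponent_3_gt[of 4]) (use k3 assms in \<open>simp_all add: power_divide\<close>)
    moreover have "b < 4"
    proof (rule ccontr)
      assume "\<not> b < 4"
      then have "3 powr \<mu> \<le> 3 / 2" using upper_powr[of 3 4] k3 by simp
      then have "(3 powr \<mu>) ^ 2 \<le> (3 / 2) ^ 2" by (intro power_mono) auto
      moreover have "7 / 5 \<le> 2 powr \<mu>" using lower_powr[of 2 4] k3 assms by simp
      then have "(7 / 5) ^ 3 \<le> (2 powr \<mu>) ^ 3" by (intro power_mono) auto
      moreover have "(2 powr \<mu>) ^ 3 \<le> (3 powr \<mu>) ^ 2"
        using powr_power_le[of 2 3 3 2 \<mu>] mu_pos by simp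
      ultimately have "(7 / 5) ^ 3 \<le> (3 / 2 :: real) ^ 2" by linarith
      then show False by (simp add: power_divide)
    qed
    ultimately show ?thesis using k3 assms by auto
  qed
qed

lemma exponent_3_le: "b \<le> k \<or> b = k + 1 \<and> k \<ge> 4"
proof (rule ccontr)
  assume *: "\<not> ?thesis"
  then have "b = k + 1" "k < 4" using exponent_3_le_exponent_2 exponent_2_le by auto
  moreover from this have "a = k + 1" using exponent_3_le_exponent_2 exponent_2_le by simp
  ultimately show False using exponents_of_exceptions by auto
qed

lemma exponent_ge_5_le:
  assumes "prime p" "p \<ge> 5"
  shows "multiplicity p N \<le> 2"
proof (rule ccontr)
  assume "\<not> multiplicity p N \<le> 2"
  moreover have "multiplicity p N \<le> b" using assms by (intro superior_exponent_antimono[OF sup k]) auto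
  moreover have "multiplicity p N \<le> multiplicity 5 N"
    using assms superior_exponent_antimono[OF sup k, of 5 p] by (cases "p = 5") auto
  ultimately show False using product_less[of 3 3 3 0] exponent_3_le_exponent_2 by simp
qed

lemma ln_prime_part_le:
  assumes "prime p" "p \<noteq> 2 \<or> a \<noteq> k + 1 \<or> k \<ge> 4"
  shows "ln (real ((k + multiplicity p N - 1) choose multiplicity p N)) \<le>
    2 * \<mu> * (real (multiplicity p N) * ln (real p))"
proof (rule ln_multichoose_le[OF sup k assms(1) multichoose_le_square_power refl])
  have p: "p = 2 \<or> p = 3 \<or> p \<ge> 5"
  proof -
    have "p \<noteq> 4" using assms(1) by auto
    then show ?thesis using prime_ge_2_nat[OF assms(1)] by linarith
  qed
  then show "multiplicity p N \<le> 10"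
    using exponent_2_small exponent_3_le_exponent_2 exponent_ge_5_le[OF assms(1)] by auto
  show "multiplicity p N \<le> k \<or> multiplicity p N = k + 1 \<and> 4 \<le> k"
    using p exponent_2_le exponent_3_le exponent_ge_5_le[OF assms(1)] k assms(2) by force
qed

text \<open>
  In the exceptional cases \<open>C(k+a-1, a)\<close> exceeds \<open>((k+a)/(a+1))\<^sup>2\<^sup>a\<close> for the exponent \<open>a\<close> of 2, but the
  corresponding inequality for the exponent of 3 has enough room to compensate for it.
\<close>

lemma ln_2_3_part_le:
  assumes "a = k + 1" "k < 4"
  shows "ln (real ((k + a - 1) choose a)) + ln (real ((k + b - 1) choose b)) \<le>
    2 * \<mu> * (real a * ln 2) + 2 * \<mu> * (real b * ln 3)"
proof -
  define u where "u = (real k + real a) / (real a + 1)"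
  define v where "v = (real k + real b) / (real b + 1)"
  have u: "u > 0" "u \<le> 2 powr \<mu>"
    using superior_exponent_lower[OF sup, of 2] k by (auto simp: u_def intro!: divide_pos_pos)
  have v: "v > 0" "v \<le> 3 powr \<mu>"
    using superior_exponent_lower[OF sup, of 3] k by (auto simp: v_def intro!: divide_pos_pos)
  have C: "real ((k + m - 1) choose m) > 0" for m
    using k by (simp add: zero_less_binomial_iff)
  have "ln (real ((k + a - 1) choose a)) + ln (real ((k + b - 1) choose b)) =
      ln (real ((k + a - 1) choose a) * real ((k + b - 1) choose b))"
    using C by (intro ln_mult_pos[symmetric])
  also have "real ((k + a - 1) choose a) * real ((k + b - 1) choose b) \<le> u ^ (2 * a) * v ^ (2 * b)"
    using exponents_of_exceptions[OF assms] unfolding u_def v_def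
    by (elim disjE conjE insertE emptyE) (simp_all add: binomial_fact' fact_numeral power_divide)
  then have "ln (real ((k + a - 1) choose a) * real ((k + b - 1) choose b)) \<le> ln (u ^ (2 * a) * v ^ (2 * b))"
    using C by (intro ln_mono mult_pos_pos)
  also have "\<dots> = 2 * real a * ln u + 2 * real b * ln v"
    using u v by (simp add: ln_mult_pos ln_realpow)
  also have "\<dots> \<le> 2 * real a * (\<mu> * ln 2) + 2 * real b * (\<mu> * ln 3)"
    using ln_mono[OF u(2,1)] ln_mono[OF v(2,1)]
    by (intro add_mono mult_left_mono) (simp_all add: ln_powr)
  finally show ?thesis by (simp add: ac_simps)
qed

lemma ln_dfact_le_ln: "ln (real (dfact k N)) \<le> 2 * \<mu> * ln (real N)"
proof -
  define g where "g p = 2 * \<mu> * (real (multiplicity p N) * ln (real p)) -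
      ln (real ((k + multiplicity p N - 1) choose multiplicity p N))" for p
  have eq: "2 * \<mu> * ln (real N) - ln (real (dfact k N)) = (\<Sum>p\<in>prime_factors N. g p)"
    using ln_dfact[OF N_pos, of k] k ln_eq_sum_prime_factors[OF N_pos]
    by (simp add: g_def sum_subtractf sum_distrib_left)
  have good: "g p \<ge> 0" if "prime p" "p \<noteq> 2 \<or> a \<noteq> k + 1 \<or> k \<ge> 4" for p
    using ln_prime_part_le[OF that] by (simp add: g_def)
  have "(\<Sum>p\<in>prime_factors N. g p) \<ge> 0"
  proof (cases "a = k + 1 \<and> k < 4")
    case False
    then show ?thesis by (intro sum_nonneg good) auto
  next
    case True
    then have "a > 0" "b > 0" using exponents_of_exceptions k by auto
    then have "2 \<in> prime_factors N" "3 \<in> prime_factors N"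
      by (simp_all add: prime_factors_multiplicity)
    then have "prime_factors N = insert 2 (insert 3 (prime_factors N - {2, 3}))" by auto
    then have "(\<Sum>p\<in>prime_factors N. g p) = (\<Sum>p\<in>insert 2 (insert 3 (prime_factors N - {2, 3})). g p)"
      by simp
    also have "\<dots> = (g 2 + g 3) + (\<Sum>p\<in>prime_factors N - {2, 3}. g p)"
      by (subst sum.insert; simp)+
    also have "\<dots> \<ge> 0"
    proof (rule add_nonneg_nonneg)
      show "g 2 + g 3 \<ge> 0" using ln_2_3_part_le True by (simp add: g_def)
      show "(\<Sum>p\<in>prime_factors N - {2, 3}. g p) \<ge> 0"
        by (intro sum_nonneg good) auto
    qed
    finally show ?thesis .
  qed
  then show ?thesis using eq by simp
qed

end

section \<open>The maximizer is large\<close>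

lemma exp_exp_2_less: "exp (exp 2) < (1728 :: real)"
proof -
  have "exp (exp 2) \<le> exp (7 * 1 + 0.39 :: real)" using exp_2_le by simp
  also have "\<dots> = exp 1 ^ 7 * exp 0.39" by (simp only: exp_add exp_of_nat_mult[of 7, simplified])
  also have "\<dots> \<le> 2.7184 ^ 7 * ((4 + 0.39) / (4 - 0.39))\<^sup>2"
    using exp_1_le by (intro mult_mono power_mono exp_le_Moebius_square) auto
  also have "\<dots> < 1728" by (simp add: power_divide power2_eq_square)
  finally show ?thesis .
qed

text \<open>
  Otherwise \<open>N\<close> maximizes \<open>ln (d\<^sub>k n)\<close> minus \<open>\<mu> (e\<^sup>2 + ln n)\<close>, the tangent of the envelope at \<open>e\<^sup>2\<close> scaled by
  \<open>\<lambda> K\<close>, and the maximum is 0. This is incompatible with \<open>ln (d\<^sub>k N) \<le> 2 \<mu> ln N\<close>.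
\<close>

lemma maximizer_large:
  assumes "k \<ge> 2" "lam > 0" "N > 0"
    and eq: "ln (real (dfact k N)) = lam * ln (real k) * envelope (ln (real N))"
    and le: "\<And>n. n > 0 \<Longrightarrow> ln (real (dfact k n)) \<le> lam * ln (real k) * envelope (ln (real n))"
  shows "ln (real N) \<ge> exp 2"
proof (rule ccontr)
  assume small: "\<not> exp 2 \<le> ln (real N)"
  define \<mu> where "\<mu> = lam * ln (real k) / 4"
  have mu: "\<mu> > 0" using assms(1,2) by (simp add: \<mu>_def)
  have N: "ln (real (dfact k N)) = \<mu> * (exp 2 + ln (real N))"
    unfolding eq using small by (simp add: envelope_def \<mu>_def)
  have "superior_highly_composite k \<mu> N"
  proof (subst superior_highly_composite_iff_ln)
    show "\<forall>n>0. ln (real (dfact k n)) - \<mu> * ln (real n) \<le> ln (real (dfact k N)) - \<mu> * ln (real N)"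
    proof (intro allI impI)
      fix n :: nat assume n: "n > 0"
      have "ln (real (dfact k n)) \<le> lam * ln (real k) * envelope (ln (real n))" by (rule le[OF n])
      also have "\<dots> \<le> lam * ln (real k) * ((exp 2 + ln (real n)) / 4)"
        using assms(1,2) n by (intro mult_left_mono envelope_le_line) auto
      also have "\<dots> = \<mu> * exp 2 + \<mu> * ln (real n)" by (simp add: \<mu>_def field_simps)
      finally show "ln (real (dfact k n)) - \<mu> * ln (real n) \<le> ln (real (dfact k N)) - \<mu> * ln (real N)"
        unfolding N by (simp add: algebra_simps)
    qed
  qed (use assms(1,3) mu in auto)
  moreover have "N < 1728"
  proof -
    have "real N = exp (ln (real N))" using assms(3) by simp
    also have "\<dots> < exp (exp 2)" using small by simp
    also have "\<dots> < 1728" by (rule exp_exp_2_less)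
    finally show ?thesis by simp
  qed
  ultimately interpret small_superior k \<mu> N
    using assms(1) by unfold_locales
  have "\<mu> * (exp 2 + ln (real N)) \<le> \<mu> * (2 * ln (real N))"
    using ln_dfact_le_ln unfolding N by (simp add: algebra_simps)
  then show False using mu small by simp
qed

section \<open>Elementary bounds for the Chebyshev function and for the number of primes\<close>

definition primes_upto :: "nat \<Rightarrow> nat set" where
  "primes_upto n = {p. prime p \<and> p \<le> n}"

definition theta :: "nat \<Rightarrow> real" where
  "theta n = (\<Sum>p\<in>primes_upto n. ln (real p))"

lemma finite_primes_upto [simp]: "finite (primes_upto n)"
  by (rule finite_subset[of _ "{..n}"]) (auto simp: primes_upto_def)

lemma theta_mono: "m \<le> n \<Longrightarrow> theta m \<le> theta n"
  unfolding theta_def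
  by (rule sum_mono2) (auto simp: primes_upto_def dest: prime_gt_0_nat)

lemma prod_primes_dvd:
  fixes n :: nat
  assumes "finite A" "\<And>p. p \<in> A \<Longrightarrow> prime p \<and> p dvd n"
  shows "\<Prod>A dvd n"
  using assms
proof (induction A)
  case (insert p A)
  have "coprime p (\<Prod>A)"
    using insert by (intro prod_coprime_right primes_coprime) auto
  then show ?case using insert by (simp add: divides_mult)
qed simp

lemma central_binomial_le: "(2 * m + 1) choose m \<le> (4 :: nat) ^ m"
proof -
  have "2 * ((2 * m + 1) choose m) = (\<Sum>k\<in>{m, Suc m}. (2 * m + 1) choose k)"
    using binomial_symmetric[of m "2 * m + 1"] by simp
  also have "\<dots> \<le> (\<Sum>k\<le>2 * m + 1. (2 * m + 1) choose k)"
    by (intro sum_mono2) auto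
  also have "\<dots> = 2 ^ (2 * m + 1)" by (rule choose_row_sum)
  also have "\<dots> = 2 * 4 ^ m" by (simp add: power_mult)
  finally show ?thesis by simp
qed

text \<open>
  The primes between \<open>m + 2\<close> and \<open>2m + 1\<close> divide the binomial coefficient \<open>C(2m+1, m) \<le> 4\<^sup>m\<close>.
\<close>

lemma theta_odd_le: "theta (2 * m + 1) \<le> theta (m + 1) + real m * ln 4"
proof -
  define A where "A = primes_upto (2 * m + 1) - primes_upto (m + 1)"
  have A: "prime p" "m + 1 < p" "p \<le> 2 * m + 1" if "p \<in> A" for p
    using that by (auto simp: A_def primes_upto_def)
  have dvd: "p dvd (2 * m + 1) choose m" if "p \<in> A" for p
  proof -
    note p = A[OF that]
    have "p dvd fact (2 * m + 1)" using p(1,3) prime_dvd_fact_iff by blast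
    also have "(fact (2 * m + 1) :: nat) = fact m * fact (2 * m + 1 - m) * ((2 * m + 1) choose m)"
      by (rule binomial_fact_lemma[symmetric]) simp
    finally have "p dvd fact m * fact (2 * m + 1 - m) * ((2 * m + 1) choose m)" .
    moreover have "\<not> p dvd fact m" "\<not> p dvd fact (2 * m + 1 - m)"
      using p unfolding prime_dvd_fact_iff[OF p(1)] by linarith+
    ultimately show ?thesis
      using p(1) prime_dvd_mult_iff by blast
  qed
  have "\<Prod>A dvd (2 * m + 1) choose m"
    using A dvd by (intro prod_primes_dvd) (auto simp: A_def)
  then have "\<Prod>A \<le> (2 * m + 1) choose m"
    by (rule dvd_imp_le) simp
  also have "\<dots> \<le> 4 ^ m" by (rule central_binomial_le)
  finally have le: "real (\<Prod>A) \<le> 4 ^ m"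
    by (metis of_nat_le_iff of_nat_numeral of_nat_power)
  have pos: "real (\<Prod>A) > 0"
    using A prime_gt_0_nat by (auto intro!: prod_pos)
  have "theta (2 * m + 1) = theta (m + 1) + (\<Sum>p\<in>A. ln (real p))"
    unfolding theta_def A_def
    by (subst sum.subset_diff[of "primes_upto (m + 1)"]) (auto simp: primes_upto_def)
  also have "(\<Sum>p\<in>A. ln (real p)) = ln (real (\<Prod>A))"
    unfolding of_nat_prod using A(1) prime_gt_0_nat by (subst ln_prod) (auto simp: A_def primes_upto_def)
  also have "\<dots> \<le> ln (4 ^ m)" using le pos by (rule ln_mono)
  finally show ?thesis by (simp add: ln_realpow)
qed

lemma theta_le: "theta n \<le> real n * ln 4"
proof (induction n rule: less_induct)
  case (less n)
  have two: "primes_upto 2 = {2}" by (auto simp: primes_upto_def dest: prime_ge_2_nat)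
  consider "n < 2" | "n = 2" | "n > 2" "even n" | "n > 2" "odd n" by linarith
  then show ?case
  proof cases
    case 1
    then have "primes_upto n = {}" by (auto simp: primes_upto_def dest: prime_ge_2_nat)
    then show ?thesis by (simp add: theta_def)
  next
    case 2
    have "ln 4 = 2 * ln (2::real)" using ln_realpow[of 2 2] by simp
    moreover have "ln (2::real) \<ge> 0" by simp
    ultimately show ?thesis using 2 two by (simp add: theta_def)
  next
    case 3
    then have "\<not> prime n" using prime_odd_nat by blast
    then have "p \<le> n \<longleftrightarrow> p \<le> n - 1" if "prime p" for p
      using 3 that by (cases "p = n") auto
    then have "primes_upto n = primes_upto (n - 1)"
      by (auto simp: primes_upto_def)
    then have "theta n \<le> real (n - 1) * ln 4" using less[of "n - 1"] 3 by (simp add: theta_def)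
    also have "\<dots> \<le> real n * ln 4" by (intro mult_right_mono) auto
    finally show ?thesis .
  next
    case 4
    then obtain m where m: "n = 2 * m + 1" by (auto elim: oddE)
    have "theta n \<le> theta (m + 1) + real m * ln 4" unfolding m by (rule theta_odd_le)
    also have "theta (m + 1) \<le> real (m + 1) * ln 4" using 4 m by (intro less) simp
    finally show ?thesis by (simp add: m algebra_simps)
  qed
qed

text \<open>
  A case distinction that is convenient for \<open>div 6\<close> and \<open>mod 6\<close>: after the substitution the simplifier
  evaluates both.
\<close>

lemma residue_6:
  fixes n :: nat
  obtains q where "n = 6 * q" | q where "n = 1 + 6 * q" | q where "n = 2 + 6 * q"
    | q where "n = 3 + 6 * q" | q where "n = 4 + 6 * q" | q where "n = 5 + 6 * q"
proof -
  define q r where "q = n div 6" and "r = n mod 6"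
  have n: "n = r + 6 * q" and "r < 6" by (simp_all add: q_def r_def)
  then consider "r = 0" | "r = 1" | "r = 2" | "r = 3" | "r = 4" | "r = 5" by linarith
  then show thesis
    using n that by cases simp_all
qed

lemma card_coprime_6: "card {p \<in> {1..n}. p mod 6 = 1 \<or> p mod 6 = 5} = (n + 5) div 6 + (n + 1) div 6"
proof (induction n)
  case (Suc n)
  define P :: "nat \<Rightarrow> bool" where "P p \<longleftrightarrow> p mod 6 = 1 \<or> p mod 6 = 5" for p
  have "{p \<in> {1..Suc n}. P p} = (if P (Suc n) then insert (Suc n) {p \<in> {1..n}. P p} else {p \<in> {1..n}. P p})"
    by (auto simp: le_Suc_eq)
  then have "card {p \<in> {1..Suc n}. P p} = card {p \<in> {1..n}. P p} + (if P (Suc n) then 1 else 0)"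
    by simp
  also have "\<dots> = (n + 5) div 6 + (n + 1) div 6 + (if P (Suc n) then 1 else 0)"
    using Suc by (simp only: P_def)
  also have "\<dots> = (Suc n + 5) div 6 + (Suc n + 1) div 6"
    by (cases n rule: residue_6) (simp_all add: P_def mod_Suc div_Suc)
  finally show ?case unfolding P_def .
qed simp

lemma prime_mod_6:
  assumes "prime (p::nat)" "p > 3"
  shows "p mod 6 = 1 \<or> p mod 6 = 5"
proof -
  have "\<not> 2 dvd p" "\<not> 3 dvd p"
    using assms primes_dvd_imp_eq[of 2 p] primes_dvd_imp_eq[of 3 p] by auto
  moreover have "2 dvd 6 * q" "2 dvd 2 + 6 * q" "3 dvd 3 + 6 * q" "2 dvd 4 + 6 * q" for q :: nat
    using dvd_triv_left[of 3 "1 + 2 * q"] by simp_all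
  moreover have "(1 + 6 * q) mod 6 = 1 mod 6" "(5 + 6 * q) mod 6 = 5 mod 6" for q :: nat
    by (rule mod_mult_self2)+
  then have "(1 + 6 * q) mod 6 = 1" "(5 + 6 * q) mod 6 = 5" for q :: nat
    by (simp_all only:) simp_all
  ultimately show ?thesis
    by (cases p rule: residue_6) metis+
qed

text \<open>
  Apart from 2 and 3, a prime is congruent to 1 or 5 modulo 6, and it is different from 1 and 25.
  Discounting 25 is what makes the constant \<open>9/25\<close> below possible.
\<close>

lemma card_primes_upto_le:
  assumes "n \<ge> 5"
  shows "card (primes_upto n) + (if n \<ge> 25 then 1 else 0) \<le> 1 + (n + 5) div 6 + (n + 1) div 6"
proof -
  define C where "C = {p \<in> {1..n}. p mod 6 = 1 \<or> p mod 6 = 5}"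
  define E where "E = (if n \<ge> 25 then {1, 25} else {1::nat})"
  have "primes_upto n \<subseteq> {2, 3} \<union> (C - E)"
  proof
    fix p assume "p \<in> primes_upto n"
    then have p: "prime p" "p \<le> n" by (simp_all add: primes_upto_def)
    have "p \<noteq> 25" using p(1) by auto
    have "p \<ge> 2" using p(1) by (rule prime_ge_2_nat)
    show "p \<in> {2, 3} \<union> (C - E)"
    proof (cases "p > 3")
      case True
      then show ?thesis
        using prime_mod_6[OF p(1) True] p(2) \<open>p \<noteq> 25\<close> unfolding C_def E_def by auto
    qed (use \<open>p \<ge> 2\<close> in auto)
  qed
  then have "card (primes_upto n) \<le> card ({2, 3} \<union> (C - E))"
    by (intro card_mono) (simp_all add: C_def)
  also have "\<dots> \<le> card {2, 3 :: nat} + card (C - E)" by (rule card_Un_le)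
  also have "card (C - E) = card C - card E"
    using assms by (intro card_Diff_subset) (simp_all add: E_def C_def)
  finally have le: "card (primes_upto n) \<le> 2 + (card C - card E)" by simp
  have E: "card E = (if n \<ge> 25 then 2 else 1)" by (simp add: E_def)
  have "card E \<le> card C"
    using assms by (intro card_mono) (simp_all add: E_def C_def)
  with le E have "card (primes_upto n) + (if n \<ge> 25 then 1 else 0) \<le> 1 + card C"
    by (cases "n \<ge> 25") simp_all
  then show ?thesis unfolding C_def card_coprime_6 by (simp only: add.assoc)
qed

lemma card_primes_upto_le_half:
  assumes "n \<ge> 8"
  shows "real (card (primes_upto n)) \<le> real n / 2"
proof -
  have "n \<ge> 5" using assms by simp
  then have "card (primes_upto n) \<le> 1 + (n + 5) div 6 + (n + 1) div 6"
    using card_primes_upto_le add_leD1 by blast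
  then have "2 * card (primes_upto n) \<le> 2 * (1 + (n + 5) div 6 + (n + 1) div 6)"
    by (rule mult_le_mono2)
  also have "\<dots> \<le> n" using assms by (cases n rule: residue_6) (simp_all add: div_Suc mod_Suc)
  finally have "real (2 * card (primes_upto n)) \<le> real n" by (rule of_nat_mono)
  then show ?thesis by simp
qed

lemma card_primes_upto_le_9_25:
  assumes "n \<ge> 25"
  shows "real (card (primes_upto n)) \<le> 9 / 25 * real n"
proof -
  define c where "c = (n + 5) div 6 + (n + 1) div 6"
  have "n \<ge> 5" using assms by simp
  from card_primes_upto_le[OF this] have "card (primes_upto n) + 1 \<le> 1 + c"
    unfolding c_def if_P[OF assms] by (simp only: add.assoc)
  then have "card (primes_upto n) \<le> (n + 5) div 6 + (n + 1) div 6"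
    unfolding c_def[symmetric] by simp
  then have "3 * card (primes_upto n) \<le> 3 * ((n + 5) div 6 + (n + 1) div 6)"
    by (rule mult_le_mono2)
  also have "\<dots> \<le> n + 2" by (cases n rule: residue_6) (simp_all add: div_Suc mod_Suc)
  finally have "real (3 * card (primes_upto n)) \<le> real (n + 2)" by (rule of_nat_mono)
  then show ?thesis using assms by simp
qed

section \<open>The Chebyshev function up to 512\<close>

definition primes_below_512 :: "int list" where
  "primes_below_512 =
   [2, 3, 5, 7, 11, 13, 17, 19, 23, 29, 31, 37, 41, 43, 47, 53, 59, 61, 67, 71, 73, 79,
    83, 89, 97, 101, 103, 107, 109, 113, 127, 131, 137, 139, 149, 151, 157, 163, 167,
    173, 179, 181, 191, 193, 197, 199, 211, 223, 227, 229, 233, 239, 241, 251, 257, 263,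
    269, 271, 277, 281, 283, 293, 307, 311, 313, 317, 331, 337, 347, 349, 353, 359, 367,
    373, 379, 383, 389, 397, 401, 409, 419, 421, 431, 433, 439, 443, 449, 457, 461, 463,
    467, 479, 487, 491, 499, 503, 509]"

text \<open>
  A number below \<open>23\<^sup>2 = 529\<close> without a proper prime factor below 23 is prime, so the primes up to 19
  sieve out exactly the primes up to 512. The list consists of integers because evaluation on them is
  binary.
\<close>

lemma sieve_512:
  "filter (\<lambda>p. list_all (\<lambda>q. p mod q \<noteq> 0 \<or> p = q) [2, 3, 5, 7, 11, 13, 17, 19]) [2..512] =
    primes_below_512"
  by code_simp

lemma set_primes_below_512:
  "set primes_below_512 =
    {p \<in> {2..512}. \<forall>q\<in>set [2, 3, 5, 7, 11, 13, 17, 19]. p mod q \<noteq> 0 \<or> p = q}"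
  unfolding sieve_512[symmetric] set_filter set_upto list_all_iff by (rule refl)

lemma mem_primes_below_512:
  fixes p :: nat
  assumes "prime p" "p \<le> 512"
  shows "int p \<in> set primes_below_512"
  unfolding set_primes_below_512
proof (intro CollectI conjI ballI)
  show "int p \<in> {2..512}" using assms prime_ge_2_nat[of p] by simp
next
  fix q :: int assume "q \<in> set [2, 3, 5, 7, 11, 13, 17, 19]"
  then have "q > 1" by auto
  define r where "r = nat q"
  have r: "q = int r" "r \<noteq> 1" using \<open>q > 1\<close> by (simp_all add: r_def)
  have "r = p" if "int p mod int r = 0"
  proof -
    have "r dvd p" using that by (simp add: mod_eq_0_iff_dvd)
    then show ?thesis using assms(1) r(2) unfolding prime_nat_iff by blast
  qed
  then show "int p mod q \<noteq> 0 \<or> int p = q" unfolding r(1) by auto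
qed

lemma theta_block_le:
  assumes "b \<le> c" "c \<le> 512"
  shows "theta c \<le> theta b + ln (real_of_int (prod_list (filter (\<lambda>p. int b < p \<and> p \<le> int c) primes_below_512)))"
    and "prod_list (filter (\<lambda>p. int b < p \<and> p \<le> int c) primes_below_512) > 0"
proof -
  define S where "S = filter (\<lambda>p. int b < p \<and> p \<le> int c) primes_below_512"
  have "distinct primes_below_512" by (simp add: primes_below_512_def)
  then have d: "distinct S" by (simp add: S_def)
  have "\<forall>p\<in>set primes_below_512. p \<ge> 2" by (simp add: primes_below_512_def)
  then have S: "p \<ge> 2" if "p \<in> set S" for p using that by (auto simp: S_def)
  have "theta c = theta b + (\<Sum>p\<in>primes_upto c - primes_upto b. ln (real p))"
    unfolding theta_def using assms(1)
    by (subst sum.subset_diff[of "primes_upto b"]) (auto simp: primes_upto_def)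
  also have "(\<Sum>p\<in>primes_upto c - primes_upto b. ln (real p)) =
      (\<Sum>p\<in>int ` (primes_upto c - primes_upto b). ln (real_of_int p))"
    by (subst sum.reindex) auto
  also have "\<dots> \<le> (\<Sum>p\<in>set S. ln (real_of_int p))"
  proof (rule sum_mono2)
    show "int ` (primes_upto c - primes_upto b) \<subseteq> set S"
      using mem_primes_below_512 assms(2) by (auto simp: S_def primes_upto_def)
  next
    fix p assume "p \<in> set S - int ` (primes_upto c - primes_upto b)"
    then show "0 \<le> ln (real_of_int p)" using S by force
  qed simp
  also have "\<dots> = ln (real_of_int (\<Prod>p\<in>set S. p))"
    unfolding of_int_prod
  proof (rule ln_prod[symmetric])
    fix p assume "p \<in> set S"
    then show "real_of_int p \<noteq> 0" using S[of p] by simp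
  qed simp
  also have "(\<Prod>p\<in>set S. p) = prod_list S"
    using d prod.distinct_set_conv_list[of S "\<lambda>p. p"] by simp
  finally show "theta c \<le> theta b + ln (real_of_int (prod_list S))" by simp
  show "prod_list S > 0" using S by (induction S) (auto intro!: mult_pos_pos, force)
qed

text \<open>
  The state of the computation of \<open>\<theta>\<close> along a grid: the interval from \<open>a\<close> to \<open>b\<close> has just been treated,
  and \<open>\<theta>(b) \<le> a + ln (r / 100)\<close>. Whenever \<open>r / 100 \<le> 210\<close>, this proves \<open>\<theta>(n) \<le> n + ln 210\<close> for all \<open>n\<close> from
  \<open>a\<close> to \<open>b\<close> at once. Carrying \<open>r\<close> along, rounded up to an integer, keeps the numbers small: a step
  multiplies only the primes of one interval.
\<close>

definition theta_bounded :: "nat \<Rightarrow> nat \<Rightarrow> int \<Rightarrow> bool" where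
  "theta_bounded a b r \<longleftrightarrow> r > 0 \<and> theta b \<le> real a + ln (real_of_int r / 100) \<and>
    (\<forall>n. 8 \<le> n \<and> n \<le> b \<longrightarrow> theta n \<le> real n + ln 210)"

text \<open>
  The power of \<open>19/7\<close> stands for a power of \<open>e\<close>, which is slightly larger.
\<close>

lemma theta_bounded_step:
  assumes "theta_bounded a b r" "a \<le> b + 1" "b \<le> c" "c \<le> 512" "0 < s" "s \<le> 21000"
    and "r * prod_list (filter (\<lambda>p. int b < p \<and> p \<le> int c) primes_below_512) * 7 ^ (b + 1 - a) \<le> s * 19 ^ (b + 1 - a)"
  shows "theta_bounded (b + 1) c s"
proof -
  define Q where "Q = prod_list (filter (\<lambda>p. int b < p \<and> p \<le> int c) primes_below_512)"
  define d where "d = b + 1 - a"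
  have Q: "Q > 0" and le: "theta c \<le> theta b + ln (real_of_int Q)"
    using theta_block_le[OF assms(3,4)] by (simp_all add: Q_def)
  have r: "r > 0" "theta b \<le> real a + ln (real_of_int r / 100)"
    and small: "\<And>n. 8 \<le> n \<Longrightarrow> n \<le> b \<Longrightarrow> theta n \<le> real n + ln 210"
    using assms(1) by (simp_all add: theta_bounded_def)
  have "real_of_int (r * Q * 7 ^ d) \<le> real_of_int (s * 19 ^ d)"
    using assms(7) unfolding Q_def d_def by (rule of_int_le_iff[THEN iffD2])
  then have "real_of_int r / 100 * real_of_int Q \<le> real_of_int s / 100 * (19 / 7) ^ d"
    by (simp add: power_divide le_divide_eq)
  then have "ln (real_of_int r / 100 * real_of_int Q) \<le> ln (real_of_int s / 100 * (19 / 7) ^ d)"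
    using r Q by (intro ln_mono) auto
  moreover have "ln (real_of_int r / 100 * real_of_int Q) = ln (real_of_int r / 100) + ln (real_of_int Q)"
    using r Q by (intro ln_mult_pos) auto
  moreover have "ln (real_of_int s / 100 * (19 / 7) ^ d) = ln (real_of_int s / 100) + ln ((19 / 7) ^ d)"
    using assms(5) by (intro ln_mult_pos) auto
  moreover have "ln ((19 / 7 :: real) ^ d) = real d * ln (19 / 7)"
    by (rule ln_realpow)
  moreover have "ln (19 / 7 :: real) \<le> 1"
    using exp_1_ge ln_mono[of "19 / 7" "exp 1"] by simp
  then have "real d * ln (19 / 7) \<le> real d"
    using mult_left_mono[of "ln (19 / 7)" 1 "real d"] by simp
  moreover have "real a + real d = real (b + 1)"
    using assms(2) by (simp add: d_def)
  ultimately have c: "theta c \<le> real (b + 1) + ln (real_of_int s / 100)"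
    using le r(2) by linarith
  have "ln (real_of_int s / 100) \<le> ln 210"
    using assms(5,6) by (intro ln_mono) auto
  then have "theta n \<le> real n + ln 210" if "b < n" "n \<le> c" for n
    using theta_mono[OF that(2)] c that(1) by linarith
  then have "\<forall>n. 8 \<le> n \<and> n \<le> c \<longrightarrow> theta n \<le> real n + ln 210"
    using small by (meson not_le)
  then show ?thesis using c assms(5) by (simp add: theta_bounded_def)
qed

text \<open>
  The slack \<open>ln 210 = \<theta>(7)\<close> is large enough that 23 grid points suffice.
\<close>

lemma theta_le_small:
  assumes "8 \<le> n" "n \<le> 512"
  shows "theta n \<le> real n + ln 210"
proof -
  have "primes_upto 0 = {}" by (auto simp: primes_upto_def)
  then have "theta_bounded 0 0 100"
    by (simp add: theta_bounded_def theta_def)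
  then have "theta_bounded 1 7 7737"
    using theta_bounded_step[of 0 0 100 7 7737] by (simp add: primes_below_512_def)
  then have "theta_bounded 8 18 17329"
    using theta_bounded_step[of 1 7 7737 18 17329] by (simp add: primes_below_512_def)
  then have "theta_bounded 19 30 3728"
    using theta_bounded_step[of 8 18 17329 30 3728] by (simp add: primes_below_512_def)
  then have "theta_bounded 31 42 1097"
    using theta_bounded_step[of 19 30 3728 42 1097] by (simp add: primes_below_512_def)
  then have "theta_bounded 43 58 735"
    using theta_bounded_step[of 31 42 1097 58 735] by (simp add: primes_below_512_def)
  then have "theta_bounded 59 72 1450"
    using theta_bounded_step[of 43 58 735 72 1450] by (simp add: primes_below_512_def)
  then have "theta_bounded 73 88 590"
    using theta_bounded_step[of 59 72 1450 88 590] by (simp add: primes_below_512_def)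
  then have "theta_bounded 89 106 6105"
    using theta_bounded_step[of 73 88 590 106 6105] by (simp add: primes_below_512_def)
  then have "theta_bounded 107 130 15981"
    using theta_bounded_step[of 89 106 6105 130 15981] by (simp add: primes_below_512_def)
  then have "theta_bounded 131 150 233"
    using theta_bounded_step[of 107 130 15981 150 233] by (simp add: primes_below_512_def)
  then have "theta_bounded 151 172 320"
    using theta_bounded_step[of 131 150 233 172 320] by (simp add: primes_below_512_def)
  then have "theta_bounded 173 196 19051"
    using theta_bounded_step[of 151 172 320 196 19051] by (simp add: primes_below_512_def)
  then have "theta_bounded 197 226 1375"
    using theta_bounded_step[of 173 196 19051 226 1375] by (simp add: primes_below_512_def)
  then have "theta_bounded 227 250 94"
    using theta_bounded_step[of 197 226 1375 250 94] by (simp add: primes_below_512_def)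
  then have "theta_bounded 251 276 4547"
    using theta_bounded_step[of 227 250 94 276 4547] by (simp add: primes_below_512_def)
  then have "theta_bounded 277 306 156"
    using theta_bounded_step[of 251 276 4547 306 156] by (simp add: primes_below_512_def)
  then have "theta_bounded 307 346 16122"
    using theta_bounded_step[of 277 306 156 346 16122] by (simp add: primes_below_512_def)
  then have "theta_bounded 347 378 153"
    using theta_bounded_step[of 307 346 16122 378 153] by (simp add: primes_below_512_def)
  then have "theta_bounded 379 418 7468"
    using theta_bounded_step[of 347 378 153 418 7468] by (simp add: primes_below_512_def)
  then have "theta_bounded 419 448 216"
    using theta_bounded_step[of 379 418 7468 448 216] by (simp add: primes_below_512_def)
  then have "theta_bounded 449 478 433"
    using theta_bounded_step[of 419 448 216 478 433] by (simp add: primes_below_512_def)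
  then have "theta_bounded 479 508 1218"
    using theta_bounded_step[of 449 478 433 508 1218] by (simp add: primes_below_512_def)
  then have "theta_bounded 509 512 1"
    using theta_bounded_step[of 479 508 1218 512 1] by (simp add: primes_below_512_def)
  then show ?thesis using assms by (simp add: theta_bounded_def)
qed

section \<open>The size of superior highly composite numbers\<close>

text \<open>
  At \<open>v = u s\<close> this is the ratio of the bound \<open>x\<^sub>2 (k - 1) s / 2\<close> for the contribution of the primes up to
  \<open>x\<^sub>2\<close> to \<open>B x\<^sub>1\<close>, see \<open>x_2_times\<close>. It has its maximum 1 at \<open>v = 1\<close>.
\<close>

definition hump :: "real \<Rightarrow> real" where "hump v = v * exp (1 - v)"

lemma hump_le_1: "hump v \<le> 1"
proof -
  have "v \<le> exp (v - 1)" using exp_ge_add_one_self[of "v - 1"] by simp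
  then have "v * exp (1 - v) \<le> exp (v - 1) * exp (1 - v)" by (intro mult_right_mono) auto
  then show ?thesis by (simp add: hump_def flip: exp_add)
qed

lemma hump_antimono:
  assumes "1 \<le> w" "w \<le> v"
  shows "hump v \<le> hump w"
proof -
  have "v / w \<le> exp (v / w - 1)" using exp_ge_add_one_self[of "v / w - 1"] by simp
  also have "v / w - 1 = (v - w) / w" using assms by (simp add: field_simps)
  also have "(v - w) / w \<le> v - w"
    using assms mult_left_mono[of 1 w "v - w"] by (simp add: divide_le_eq)
  finally have "v / w \<le> exp (v - w)" by simp
  then have "v \<le> w * exp (v - w)" using assms by (simp add: field_simps)
  then have "v * exp (1 - v) \<le> w * exp (v - w) * exp (1 - v)" by (intro mult_right_mono) auto
  also have "\<dots> = w * exp (1 - w)" by (simp add: mult.assoc flip: exp_add)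
  finally show ?thesis by (simp add: hump_def)
qed

lemma hump_le_of_le:
  assumes "1 \<le> w" "w \<le> v" "w \<le> g * (2.718 * (1 + (w - 2) / 2 + ((w - 2) / 2)\<^sup>2 / 2)\<^sup>2)" "w \<ge> 2" "g \<ge> 0"
  shows "hump v \<le> g"
proof -
  have "2.718 * (1 + (w - 2) / 2 + ((w - 2) / 2)\<^sup>2 / 2)\<^sup>2 \<le> exp 1 * exp (w - 2)"
    using assms exp_1_ge by (intro mult_mono le_exp_half_square) auto
  also have "\<dots> = exp (w - 1)" by (simp flip: exp_add)
  finally have "g * (2.718 * (1 + (w - 2) / 2 + ((w - 2) / 2)\<^sup>2 / 2)\<^sup>2) \<le> g * exp (w - 1)"
    using assms(5) by (rule mult_left_mono)
  then have "w \<le> g * exp (w - 1)" using assms(3) by linarith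
  then have "w * exp (1 - w) \<le> g * exp (w - 1) * exp (1 - w)" by (intro mult_right_mono) auto
  also have "\<dots> = g" by (simp add: mult.assoc flip: exp_add)
  finally have "hump w \<le> g" by (simp add: hump_def)
  then show ?thesis using hump_antimono[OF assms(1,2)] by simp
qed

text \<open>
  Below, \<open>x\<^sub>1\<close> and \<open>x\<^sub>2\<close> bound the primes that can have an exponent of at least 1 or 2, respectively. The
  condition \<open>\<epsilon> \<le> \<epsilon>\<^sub>0 k\<close> says precisely that \<open>x\<^sub>2 \<ge> 8\<close>, from where on \<open>\<pi>(y) \<le> y / 2\<close>.
\<close>

locale small_epsilon =
  fixes k :: nat and \<epsilon> :: real
  assumes k: "k \<ge> 2" and eps_pos: "\<epsilon> > 0" and eps_le: "\<epsilon> \<le> \<epsilon>\<^sub>0 k"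
begin

definition s :: real where "s = 1 / \<epsilon>"
definition x\<^sub>1 :: real where "x\<^sub>1 = real k powr s"
definition x\<^sub>2 :: real where "x\<^sub>2 = ((real k + 1) / 2) powr s"
definition u :: real where "u = ln (2 * real k / (real k + 1))"
definition B :: real where "B = (real k - 1) / (2 * exp 1 * u)"

lemma s_pos: "s > 0" using eps_pos by (simp add: s_def)

lemma u_pos: "u > 0" using k by (simp add: u_def field_simps)

lemma B_pos: "B > 0" using k u_pos by (simp add: B_def)

lemma c_1_eq: "c\<^sub>1 k = B + \<omega>\<^sub>2"
  by (simp add: c\<^sub>1_def B_def u_def)

lemma x_1_pos: "x\<^sub>1 > 0" using k by (simp add: x\<^sub>1_def)

lemma x_2_eq: "x\<^sub>2 = x\<^sub>1 * exp (- (u * s))"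
proof -
  have "(real k + 1) / 2 = real k / (2 * real k / (real k + 1))"
    using k by (simp add: field_simps)
  also have "\<dots> powr s = real k powr s / (2 * real k / (real k + 1)) powr s"
    by (rule powr_divide)
  also have "(2 * real k / (real k + 1)) powr s = exp (u * s)"
    using k by (simp add: powr_def u_def mult.commute)
  finally show ?thesis
    by (simp add: x\<^sub>1_def x\<^sub>2_def exp_minus field_simps)
qed

lemma x_2_ge: "x\<^sub>2 \<ge> 8"
proof -
  have "ln 8 \<le> s * ln ((real k + 1) / 2)"
    using eps_le eps_pos by (simp add: s_def \<epsilon>\<^sub>0_def field_simps)
  then have "exp (ln 8) \<le> exp (s * ln ((real k + 1) / 2))" by (rule exp_le_cancel_iff[THEN iffD2])
  then show ?thesis using k by (simp add: x\<^sub>2_def powr_def)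
qed

lemma x_2_le_x_1: "x\<^sub>2 \<le> x\<^sub>1"
  unfolding x_2_eq using x_1_pos u_pos s_pos by (simp add: mult_le_cancel_left1)

lemma powr_le_iff:
  assumes "p > 0" "y > 0"
  shows "real p powr \<epsilon> \<le> y \<longleftrightarrow> real p \<le> y powr s"
proof -
  have "real p powr \<epsilon> \<le> y \<longleftrightarrow> \<epsilon> * ln (real p) \<le> ln y"
    using assms ln_le_cancel_iff[of "real p powr \<epsilon>" y] by (simp add: ln_powr)
  also have "\<dots> \<longleftrightarrow> ln (real p) \<le> s * ln y"
    using eps_pos by (simp add: s_def field_simps)
  also have "\<dots> \<longleftrightarrow> real p \<le> y powr s"
    using assms ln_le_cancel_iff[of "real p" "y powr s"] by (simp add: ln_powr)
  finally show ?thesis .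
qed

text \<open>
  From \<open>p\<^sup>\<epsilon> \<le> 1 + (k-1)/a\<close> and \<open>1 + \<epsilon> ln p \<le> p\<^sup>\<epsilon>\<close>.
\<close>

lemma exponent_times_ln_le:
  assumes "superior_highly_composite k \<epsilon> N" "prime p"
  shows "real (multiplicity p N) * ln (real p) \<le> real (k - 1) * s"
proof (cases "multiplicity p N = 0")
  case False
  define a where "a = multiplicity p N"
  have a: "a > 0" using False by (simp add: a_def)
  have p: "p > 0" using assms(2) by (rule prime_gt_0_nat)
  have "1 + \<epsilon> * ln (real p) \<le> real p powr \<epsilon>"
    using p exp_ge_add_one_self[of "\<epsilon> * ln (real p)"] by (simp add: powr_def)
  also have "\<dots> \<le> (real k + real a - 1) / real a"
    using superior_exponent_upper[OF assms(1) _ assms(2)] k a by (simp add: a_def)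
  finally have "\<epsilon> * (real a * ln (real p)) \<le> real k - 1"
    using a by (simp add: field_simps)
  then show ?thesis
    using eps_pos k by (simp add: s_def a_def[symmetric] field_simps of_nat_diff)
qed (use s_pos in simp)

text \<open>
  The term \<open>- \<theta>(x\<^sub>2)\<close> is kept because it pays for the excess \<open>ln 210\<close> of the bound for \<open>\<theta>(x\<^sub>1)\<close>
  when \<open>x\<^sub>1 \<le> 512\<close>.
\<close>

lemma ln_superior_le:
  assumes "superior_highly_composite k \<epsilon> N"
  shows "ln (real N) \<le> real (card (primes_upto (nat \<lfloor>x\<^sub>2\<rfloor>))) * (real (k - 1) * s)
    + (theta (nat \<lfloor>x\<^sub>1\<rfloor>) - theta (nat \<lfloor>x\<^sub>2\<rfloor>))"
proof -
  define X1 X2 where "X1 = primes_upto (nat \<lfloor>x\<^sub>1\<rfloor>)" and "X2 = primes_upto (nat \<lfloor>x\<^sub>2\<rfloor>)"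
  have X1: "p \<in> X1 \<longleftrightarrow> prime p \<and> real p \<le> x\<^sub>1" for p
    using x_1_pos by (simp add: X1_def primes_upto_def le_nat_iff le_floor_iff)
  have X2: "p \<in> X2 \<longleftrightarrow> prime p \<and> real p \<le> x\<^sub>2" for p
    using x_2_ge by (simp add: X2_def primes_upto_def le_nat_iff le_floor_iff)
  have fin: "finite X1" "finite X2" by (simp_all add: X1_def X2_def)
  have sub: "X2 \<subseteq> X1" using X1 X2 x_2_le_x_1 by force
  have N: "N > 0" using assms by (simp add: superior_highly_composite_def)
  define f where "f p = real (multiplicity p N) * ln (real p)" for p
  have in_X1: "p \<in> X1" if "prime p" "multiplicity p N > 0" for p
  proof -
    have "real p powr \<epsilon> \<le> 1 + (real k - 1) / real (multiplicity p N)"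
      using superior_exponent_upper[OF assms _ that] k that by (simp add: field_simps)
    also have "\<dots> \<le> 1 + (real k - 1) / 1"
      using that k by (intro add_left_mono divide_left_mono) auto
    finally show ?thesis
      using that k prime_gt_0_nat[OF that(1)] by (simp add: X1 x\<^sub>1_def powr_le_iff)
  qed
  have mult_le: "multiplicity p N \<le> 1" if "prime p" "p \<notin> X2" for p
  proof (rule ccontr)
    assume m: "\<not> multiplicity p N \<le> 1"
    have "real p powr \<epsilon> \<le> 1 + (real k - 1) / real (multiplicity p N)"
      using superior_exponent_upper[OF assms _ that(1)] k m by (simp add: field_simps)
    also have "\<dots> \<le> 1 + (real k - 1) / 2"
      using m k by (intro add_left_mono divide_left_mono) auto
    also have "\<dots> = (real k + 1) / 2" by (simp add: field_simps)
    finally show False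
      using that k prime_gt_0_nat[OF that(1)] powr_le_iff[of p "(real k + 1) / 2"] by (simp add: X2 x\<^sub>2_def)
  qed
  have "ln (real N) = (\<Sum>p\<in>prime_factors N. f p)"
    using ln_eq_sum_prime_factors[OF N] by (simp add: f_def)
  also have "\<dots> \<le> (\<Sum>p\<in>X1. f p)"
  proof (rule sum_mono2[OF fin(1)])
    show "prime_factors N \<subseteq> X1" using in_X1 by (auto simp: prime_factors_multiplicity)
    show "f p \<ge> 0" if "p \<in> X1 - prime_factors N" for p
      using that X1 prime_gt_0_nat[of p] by (simp add: f_def)
  qed
  also have "\<dots> = (\<Sum>p\<in>X2. f p) + (\<Sum>p\<in>X1 - X2. f p)"
    using sub fin by (simp add: sum.subset_diff add.commute)
  also have "(\<Sum>p\<in>X2. f p) \<le> (\<Sum>p\<in>X2. real (k - 1) * s)"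
    using exponent_times_ln_le[OF assms] X2 by (intro sum_mono) (simp add: f_def)
  also have "(\<Sum>p\<in>X1 - X2. f p) \<le> (\<Sum>p\<in>X1 - X2. 1 * ln (real p))"
  proof (rule sum_mono)
    fix p assume p: "p \<in> X1 - X2"
    then have "prime p" "p \<notin> X2" using X1 by auto
    then have "real (multiplicity p N) \<le> 1" using mult_le by simp
    then show "f p \<le> 1 * ln (real p)"
      unfolding f_def using prime_gt_0_nat[OF \<open>prime p\<close>] by (intro mult_right_mono) auto
  qed
  also have "(\<Sum>p\<in>X1 - X2. 1 * ln (real p)) = theta (nat \<lfloor>x\<^sub>1\<rfloor>) - theta (nat \<lfloor>x\<^sub>2\<rfloor>)"
    using sub fin by (simp add: theta_def X1_def[symmetric] X2_def[symmetric] sum_diff)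
  finally show ?thesis by (simp add: X2_def)
qed

text \<open>
  The left side is twice the bound for the contribution of the primes up to \<open>x\<^sub>2\<close> when \<open>\<pi>(x\<^sub>2) \<le> x\<^sub>2 / 2\<close>. The
  first summand of \<open>c\<^sub>1 k\<close>, here called \<open>B\<close>, is what remains when the hump is replaced by its maximum 1.
\<close>

lemma x_2_times: "x\<^sub>2 * (real (k - 1) * s) = 2 * B * hump (u * s) * x\<^sub>1"
  using u_pos k unfolding x_2_eq B_def hump_def by (simp add: exp_diff exp_minus field_simps of_nat_diff)

lemma theta_x_2_ge: "theta (nat \<lfloor>x\<^sub>2\<rfloor>) \<ge> ln 210"
proof -
  have "primes_upto 7 = {2, 3, 5, 7}"
  proof -
    have "p = 2 \<or> p = 3 \<or> p = 5 \<or> p = 7" if "prime p" "p \<le> 7" for p :: nat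
    proof -
      have "p \<noteq> 4" "p \<noteq> 6" using that(1) by auto
      then show ?thesis using prime_ge_2_nat[OF that(1)] that(2) by linarith
    qed
    then show ?thesis by (auto simp: primes_upto_def)
  qed
  then have "theta 7 = ln 2 + ln 3 + ln 5 + ln 7" by (simp add: theta_def)
  also have "\<dots> = ln (2 * 3 * 5 * 7)" by (simp only: ln_mult_pos[symmetric])
  finally have "ln 210 = theta 7" by simp
  also have "\<dots> \<le> theta (nat \<lfloor>x\<^sub>2\<rfloor>)"
    using x_2_ge by (intro theta_mono) (simp add: le_nat_iff le_floor_iff)
  finally show ?thesis .
qed

lemma card_x_2_le_half: "real (card (primes_upto (nat \<lfloor>x\<^sub>2\<rfloor>))) \<le> 1 / 2 * x\<^sub>2"
proof -
  have "nat \<lfloor>x\<^sub>2\<rfloor> \<ge> 8" using x_2_ge by (simp add: le_nat_iff le_floor_iff)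
  then have "real (card (primes_upto (nat \<lfloor>x\<^sub>2\<rfloor>))) \<le> real (nat \<lfloor>x\<^sub>2\<rfloor>) / 2"
    by (rule card_primes_upto_le_half)
  also have "\<dots> \<le> 1 / 2 * x\<^sub>2" using x_2_ge by simp
  finally show ?thesis .
qed

lemma ln_superior_le_small:
  assumes "superior_highly_composite k \<epsilon> N" "x\<^sub>1 \<le> 512"
  shows "ln (real N) \<le> c\<^sub>1 k * x\<^sub>1"
proof -
  define n where "n = nat \<lfloor>x\<^sub>1\<rfloor>"
  have n: "8 \<le> n" "n \<le> 512" "real n \<le> x\<^sub>1"
    using x_2_ge x_2_le_x_1 assms(2) by (simp_all add: n_def le_nat_iff le_floor_iff; linarith)+
  have "real (card (primes_upto (nat \<lfloor>x\<^sub>2\<rfloor>))) * (real (k - 1) * s) \<le> x\<^sub>2 / 2 * (real (k - 1) * s)"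
    using s_pos card_x_2_le_half by (intro mult_right_mono) auto
  also have "\<dots> = B * x\<^sub>1 * hump (u * s)" using x_2_times by simp
  also have "\<dots> \<le> B * x\<^sub>1 * 1"
    using hump_le_1 B_pos x_1_pos by (intro mult_left_mono) auto
  finally have "ln (real N) \<le> B * x\<^sub>1 + x\<^sub>1"
    using ln_superior_le[OF assms(1)] theta_le_small[OF n(1,2)] theta_x_2_ge n(3)
    unfolding n_def by linarith
  also have "\<dots> \<le> c\<^sub>1 k * x\<^sub>1"
    using x_1_pos by (simp add: c_1_eq \<omega>\<^sub>2_def algebra_simps)
  finally show ?thesis .
qed

text \<open>
  The number \<open>7/18\<close> is \<open>25/18 - 1\<close>, where \<open>25/18\<close> is an upper bound for \<open>ln 4\<close>.
\<close>

lemma ln_superior_le_large: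
  assumes "superior_highly_composite k \<epsilon> N"
    and "real (card (primes_upto (nat \<lfloor>x\<^sub>2\<rfloor>))) \<le> \<alpha> * x\<^sub>2"
    and "7 / 18 \<le> B * (1 - 2 * \<alpha> * hump (u * s))"
  shows "ln (real N) \<le> c\<^sub>1 k * x\<^sub>1"
proof -
  have "theta (nat \<lfloor>x\<^sub>1\<rfloor>) \<le> real (nat \<lfloor>x\<^sub>1\<rfloor>) * ln 4" by (rule theta_le)
  also have "ln (4::real) = 2 * ln 2" using ln_realpow[of 2 2] by simp
  also have "real (nat \<lfloor>x\<^sub>1\<rfloor>) * (2 * ln 2) \<le> x\<^sub>1 * (25 / 18)"
    using x_1_pos ln2_le_25_over_36 by (intro mult_mono) auto
  finally have th: "theta (nat \<lfloor>x\<^sub>1\<rfloor>) \<le> x\<^sub>1 * (25 / 18)" .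
  have "real (card (primes_upto (nat \<lfloor>x\<^sub>2\<rfloor>))) * (real (k - 1) * s) \<le> \<alpha> * x\<^sub>2 * (real (k - 1) * s)"
    using s_pos assms(2) by (intro mult_right_mono) auto
  also have "\<dots> = 2 * \<alpha> * B * hump (u * s) * x\<^sub>1" using x_2_times by (simp add: ac_simps)
  finally have "ln (real N) \<le> 2 * \<alpha> * B * hump (u * s) * x\<^sub>1 + x\<^sub>1 * (25 / 18)"
    using ln_superior_le[OF assms(1)] th theta_x_2_ge ln_ge_zero[of 210] by linarith
  also have "\<dots> = (2 * \<alpha> * B * hump (u * s) + 25 / 18) * x\<^sub>1" by (simp add: algebra_simps)
  also have "\<dots> \<le> c\<^sub>1 k * x\<^sub>1"
    using assms(3) x_1_pos by (intro mult_right_mono) (simp_all add: c_1_eq \<omega>\<^sub>2_def algebra_simps)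
  finally show ?thesis .
qed

lemma card_x_2_le_9_25:
  assumes "x\<^sub>2 \<ge> 25"
  shows "real (card (primes_upto (nat \<lfloor>x\<^sub>2\<rfloor>))) \<le> 9 / 25 * x\<^sub>2"
proof -
  have "nat \<lfloor>x\<^sub>2\<rfloor> \<ge> 25" using assms by (simp add: le_nat_iff le_floor_iff)
  then have "real (card (primes_upto (nat \<lfloor>x\<^sub>2\<rfloor>))) \<le> 9 / 25 * real (nat \<lfloor>x\<^sub>2\<rfloor>)"
    by (rule card_primes_upto_le_9_25)
  also have "\<dots> \<le> 9 / 25 * x\<^sub>2" using x_2_ge by simp
  finally show ?thesis .
qed

lemma B_ge:
  assumes "u \<le> w"
  shows "(real k - 1) / (5.4368 * w) \<le> B"
  unfolding B_def
proof (rule divide_left_mono)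
  show "2 * exp 1 * u \<le> 5.4368 * w"
    using exp_1_le u_pos assms by (intro mult_mono) auto
  show "0 < 5.4368 * w * (2 * exp 1 * u)"
    using u_pos assms by simp
qed (use k in simp)

lemma B_ge_7_5:
  assumes "k \<ge> 5"
  shows "7 / 5 \<le> B"
proof -
  consider "k = 5" | "k = 6" | "k \<ge> 7" using assms by linarith
  then show ?thesis
  proof cases
    case 1
    then have "u \<le> 0.52"
      unfolding u_def by (intro ln_le_of_square) (simp_all add: power2_eq_square)
    from B_ge[OF this] show ?thesis using 1 by simp
  next
    case 2
    then have "u \<le> 0.55"
      unfolding u_def by (intro ln_le_of_square) (simp_all add: power2_eq_square)
    from B_ge[OF this] show ?thesis using 2 by simp
  next
    case 3
    have "u \<le> ln 2"
      unfolding u_def using k by (intro ln_mono) (simp_all add: divide_le_eq)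
    then have "u \<le> 25 / 36" using ln2_le_25_over_36 by simp
    from B_ge[OF this] show ?thesis using 3 by simp
  qed
qed

lemma slack_9_25:
  assumes "hump (u * s) \<le> g" "b \<le> B" "7 / 18 \<le> b * (1 - 18 / 25 * g)" "g \<le> 1"
  shows "7 / 18 \<le> B * (1 - 2 * (9 / 25) * hump (u * s))"
proof -
  have "b * (1 - 18 / 25 * g) \<le> B * (1 - 2 * (9 / 25) * hump (u * s))"
    using assms B_pos by (intro mult_mono) auto
  then show ?thesis using assms(3) by linarith
qed

lemma s_ge:
  assumes "x\<^sub>1 > 512" "real k powr t \<le> 512"
  shows "t \<le> s"
proof -
  have "real k powr t < real k powr s" using assms by (simp add: x\<^sub>1_def)
  then show ?thesis using k by simp
qed

lemma x_2_ge_powr: "t \<le> s \<Longrightarrow> ((real k + 1) / 2) powr t \<le> x\<^sub>2"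
  unfolding x\<^sub>2_def using k by (intro powr_mono) auto

text \<open>
  For \<open>x\<^sub>1 > 512\<close> there is slack for two reasons. If \<open>x\<^sub>2 \<ge> 25\<close>, then \<open>\<pi>(x\<^sub>2) \<le> 9/25 x\<^sub>2\<close> instead of \<open>x\<^sub>2 / 2\<close>; for
  \<open>k \<ge> 5\<close> this is enough, because \<open>B \<ge> 7/5\<close>. For \<open>k \<le> 4\<close> the constant \<open>B\<close> is smaller, but \<open>s\<close> is so large
  that \<open>u s\<close> is well beyond 1 and the hump is small. If \<open>x\<^sub>2 < 25\<close>, then \<open>e\<^bsup>us\<^esup> = x\<^sub>1 / x\<^sub>2\<close> is large, and again the
  hump is small.
\<close>

lemma ln_superior_le_c_1:
  assumes "superior_highly_composite k \<epsilon> N"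
  shows "ln (real N) \<le> c\<^sub>1 k * real k powr (1 / \<epsilon>)"
proof -
  \<comment> \<open>the threshold 512 is the end of the table for \<open>\<theta>\<close>; for \<open>k = 2\<close> it means \<open>s > 9\<close>\<close>
  have "ln (real N) \<le> c\<^sub>1 k * x\<^sub>1"
  proof (cases "x\<^sub>1 \<le> 512")
    case True
    then show ?thesis by (rule ln_superior_le_small[OF assms])
  next
    case False
    then have x1: "x\<^sub>1 > 512" by simp
    consider "k = 2" | "k = 3" | "k = 4" | "k \<ge> 5" using k by linarith
    then show ?thesis
    proof cases
      case 1
      have s: "9 \<le> s" using s_ge[OF x1, of 9] 1 by simp
      have "x\<^sub>2 \<ge> 25" using x_2_ge_powr[OF s] 1 by (simp add: power_divide)
      have u: "u = ln (4 / 3)" unfolding u_def using 1 by simp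
      have "0.2867 \<le> u" unfolding u by (rule ln_ge_of_Moebius) (simp_all add: power_divide)
      then have "0.2867 * 9 \<le> u * s" using s by (intro mult_mono) auto
      then have "hump (u * s) \<le> 0.54"
        by (intro hump_le_of_le[of "2.58"]) (simp_all add: power2_eq_square)
      moreover have "u \<le> 0.289" unfolding u by (rule ln_le_of_square) (simp_all add: power2_eq_square)
      note B_ge[OF this]
      ultimately have "7 / 18 \<le> B * (1 - 2 * (9 / 25) * hump (u * s))"
        by (rule slack_9_25) (simp_all add: 1)
      then show ?thesis
        by (rule ln_superior_le_large[OF assms card_x_2_le_9_25[OF \<open>x\<^sub>2 \<ge> 25\<close>]])
    next
      case 2
      have s: "5 \<le> s" using s_ge[OF x1, of 5] 2 by simp
      have "x\<^sub>2 \<ge> 25" using x_2_ge_powr[OF s] 2 by simp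
      have u: "u = ln (3 / 2)" unfolding u_def using 2 by simp
      have "0.4 \<le> u" unfolding u by (rule ln_ge_of_Moebius) (simp_all add: power_divide)
      then have "0.4 * 5 \<le> u * s" using s by (intro mult_mono) auto
      then have "hump (u * s) \<le> 0.74"
        by (intro hump_le_of_le[of "2"]) simp_all
      moreover have "u \<le> 0.41" unfolding u by (rule ln_le_of_square) (simp_all add: power2_eq_square)
      note B_ge[OF this]
      ultimately have "7 / 18 \<le> B * (1 - 2 * (9 / 25) * hump (u * s))"
        by (rule slack_9_25) (simp_all add: 2)
      then show ?thesis
        by (rule ln_superior_le_large[OF assms card_x_2_le_9_25[OF \<open>x\<^sub>2 \<ge> 25\<close>]])
    next
      case 3
      have "(4::real) powr 4.5 = 2 powr 9"
        using powr_powr[of 2 2 "4.5 :: real"] by simp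
      then have s: "4.5 \<le> s" using s_ge[OF x1, of "4.5"] 3 by simp
      have "(2.5::real) powr 4 \<le> 2.5 powr 4.5" by (intro powr_mono) auto
      then have "x\<^sub>2 \<ge> 25" using x_2_ge_powr[OF s] 3 by (simp add: power_divide)
      have u: "u = ln (8 / 5)" unfolding u_def using 3 by simp
      have "0.45 \<le> u" unfolding u by (rule ln_ge_of_Moebius) (simp_all add: power_divide)
      then have "0.45 * 4.5 \<le> u * s" using s by (intro mult_mono) auto
      then have "hump (u * s) \<le> 0.74"
        by (intro hump_le_of_le[of "2"]) simp_all
      moreover have "u \<le> 0.475" unfolding u by (rule ln_le_of_square) (simp_all add: power2_eq_square)
      note B_ge[OF this]
      ultimately have "7 / 18 \<le> B * (1 - 2 * (9 / 25) * hump (u * s))"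
        by (rule slack_9_25) (simp_all add: 3)
      then show ?thesis
        by (rule ln_superior_le_large[OF assms card_x_2_le_9_25[OF \<open>x\<^sub>2 \<ge> 25\<close>]])
    next
      case 4
      note B = B_ge_7_5[OF 4]
      show ?thesis
      proof (cases "x\<^sub>2 \<ge> 25")
        case True
        have "7 / 18 \<le> B * (1 - 2 * (9 / 25) * hump (u * s))"
          using hump_le_1 B by (rule slack_9_25) simp_all
        then show ?thesis
          by (rule ln_superior_le_large[OF assms card_x_2_le_9_25[OF True]])
      next
        case False
        have "exp 3 \<le> exp (u * s)"
        proof -
          have "exp (3::real) = exp 1 ^ 3" by (simp flip: exp_of_nat_mult)
          also have "\<dots> \<le> 2.7184 ^ 3" using exp_1_le by (intro power_mono) auto
          also have "\<dots> \<le> 512 / 25" by (simp add: power_divide)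
          finally have "25 * exp 3 \<le> (512::real)" by simp
          also have "\<dots> < x\<^sub>1" by (rule x1)
          also have "x\<^sub>1 = x\<^sub>2 * exp (u * s)" unfolding x_2_eq by (simp flip: exp_add)
          also have "\<dots> \<le> 25 * exp (u * s)" using False by (intro mult_right_mono) auto
          finally show ?thesis by simp
        qed
        then have "hump (u * s) \<le> 0.42"
          by (intro hump_le_of_le[of 3]) (simp_all add: power2_eq_square)
        then have "1.4 * (1 - 0.42) \<le> B * (1 - 2 * (1 / 2) * hump (u * s))"
          using B by (intro mult_mono) auto
        then have "7 / 18 \<le> B * (1 - 2 * (1 / 2) * hump (u * s))" by simp
        then show ?thesis
          by (rule ln_superior_le_large[OF assms card_x_2_le_half])
      qed
    qed
  qed
  then show ?thesis by (simp add: x\<^sub>1_def s_def)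
qed

end

section \<open>The parameter of the maximizer\<close>

text \<open>
  With \<open>C = ln (c\<^sub>1 k) \<ge> 0\<close>, cross-multiplying leaves a polynomial whose only possibly negative term
  comes from \<open>C < 1\<close>. It is controlled by \<open>e' \<le> \<epsilon>\<^sub>0 k \<le> K / 2\<close>, which also makes the denominators positive.
\<close>

lemma lambda_1_mono:
  assumes "k \<ge> 2" "0 < e" "e \<le> e'" "e' \<le> \<epsilon>\<^sub>0 k"
  shows "lambda\<^sub>1 k e \<le> lambda\<^sub>1 k e'"
proof -
  define K where "K = ln (real k)"
  define C where "C = ln (c\<^sub>1 k)"
  have K: "K > 0" using assms(1) by (simp add: K_def)
  have "c\<^sub>1 k \<ge> 1"
  proof -
    interpret small_epsilon k e using assms by unfold_locales auto
    show ?thesis using B_pos by (simp add: c_1_eq \<omega>\<^sub>2_def)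
  qed
  then have C: "C \<ge> 0" by (simp add: C_def)
  have "\<epsilon>\<^sub>0 k \<le> K / 2"
  proof -
    have "ln ((real k + 1) / 2) \<le> K" using assms(1) unfolding K_def by (intro ln_mono) auto
    moreover have "ln (8::real) = 3 * ln 2" using ln_realpow[of 2 3] by simp
    then have "ln (8::real) \<ge> 2" using ln2_ge_two_thirds by simp
    ultimately show ?thesis unfolding \<epsilon>\<^sub>0_def
      using K by (intro frac_le) auto
  qed
  then have e: "e' \<le> K / 2" using assms(4) by simp
  have den: "K + (C - 1) * z > 0" if "0 < z" "z \<le> e'" for z
  proof -
    have "0 \<le> C * z" using C that by simp
    moreover have "z \<le> K / 2" using that e by simp
    ultimately show ?thesis using K by (simp add: algebra_simps)
  qed
  have "(K + e * C)\<^sup>2 * (K + (C - 1) * e') \<le> (K + e' * C)\<^sup>2 * (K + (C - 1) * e)"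
  proof -
    have "(K + e' * C)\<^sup>2 * (K + (C - 1) * e) - (K + e * C)\<^sup>2 * (K + (C - 1) * e') =
        (e' - e) * (K\<^sup>2 * (C + 1) + K * C\<^sup>2 * (e + e') + C\<^sup>2 * (C - 1) * e * e')"
      by (simp add: power2_eq_square algebra_simps)
    also have "\<dots> \<ge> 0"
    proof (rule mult_nonneg_nonneg)
      have "C\<^sup>2 * (e * e') \<le> C\<^sup>2 * (K * e')"
        using e assms K by (intro mult_left_mono mult_right_mono) auto
      moreover have "0 \<le> C\<^sup>2 * C * e * e'" "0 \<le> K\<^sup>2 * (C + 1)" "0 \<le> K * C\<^sup>2 * e"
        using C K assms by auto
      ultimately show "0 \<le> K\<^sup>2 * (C + 1) + K * C\<^sup>2 * (e + e') + C\<^sup>2 * (C - 1) * e * e'"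
        by (simp add: algebra_simps)
    qed (use assms in simp)
    finally show ?thesis by simp
  qed
  then have "(K + e * C)\<^sup>2 / (K + (C - 1) * e) \<le> (K + e' * C)\<^sup>2 / (K + (C - 1) * e')"
    using den[of e] den[of e'] assms by (simp add: divide_le_eq le_divide_eq field_simps)
  then have "(K + e * C)\<^sup>2 / (K + (C - 1) * e) / K \<le> (K + e' * C)\<^sup>2 / (K + (C - 1) * e') / K"
    using K by (intro divide_right_mono) auto
  then show "lambda\<^sub>1 k e \<le> lambda\<^sub>1 k e'"
    by (simp add: lambda\<^sub>1_def K_def C_def mult.commute)
qed

lemma square_over_pred_mono:
  fixes L M :: real
  assumes "2 \<le> L" "L \<le> M"
  shows "L\<^sup>2 / (L - 1) \<le> M\<^sup>2 / (M - 1)"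
proof -
  have "M\<^sup>2 * (L - 1) - L\<^sup>2 * (M - 1) = (M - L) * ((L - 1) * (M - 1) - 1)"
    by (simp add: power2_eq_square algebra_simps)
  also have "\<dots> \<ge> 0"
  proof (rule mult_nonneg_nonneg)
    have "1 * 1 \<le> (L - 1) * (M - 1)" using assms by (intro mult_mono) auto
    then show "0 \<le> (L - 1) * (M - 1) - 1" by simp
  qed (use assms in simp)
  finally show ?thesis using assms by (simp add: field_simps)
qed

theorem theorem5p8:
  fixes k :: nat
  assumes "k \<ge> 2"
  shows "\<exists>(lam :: real) (Nmax :: nat) (eps :: real).
      (\<forall>n\<ge>3. fratio k n \<le> lam) \<and>
      Nmax \<ge> 3 \<and> fratio k Nmax = lam \<and>
      eps > 0 \<and> superior_highly_composite k eps Nmax \<and>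
      (\<forall>\<epsilon>\<^sub>1 \<epsilon>\<^sub>2 :: real.
         0 < \<epsilon>\<^sub>1 \<longrightarrow> \<epsilon>\<^sub>1 \<le> \<epsilon>\<^sub>0 k \<longrightarrow> admissible k \<epsilon>\<^sub>2 \<longrightarrow> lambda\<^sub>1 k \<epsilon>\<^sub>1 < lam \<longrightarrow>
         \<epsilon>\<^sub>1 \<le> eps \<and> eps \<le> \<epsilon>\<^sub>2)"
proof -
  define K where "K = ln (real k)"
  have K: "K > 0" using assms by (simp add: K_def)
  obtain lam N where lam: "lam > 0" and N: "N > 0"
    and eq: "ln (real (dfact k N)) = lam * K * envelope (ln (real N))"
    and le: "\<And>n. n > 0 \<Longrightarrow> ln (real (dfact k n)) \<le> lam * K * envelope (ln (real n))"
    using exists_maximizer[OF assms] unfolding K_def by blast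
  define t where "t = ln (real N)"
  define L where "L = ln t"
  have t: "t \<ge> exp 2"
    unfolding t_def using maximizer_large[OF assms lam N] eq le unfolding K_def by blast
  have t_pos: "t > 0" using t exp_gt_zero[of 2] by linarith
  have L: "L \<ge> 2" using t t_pos by (simp add: L_def ln_ge_iff)
  have eqt: "ln (real (dfact k N)) = lam * K * (t / L)"
    unfolding eq t_def[symmetric] using t by (simp add: envelope_def L_def)
  define eps where "eps = lam * K * ((L - 1) / L\<^sup>2)"
  have eps: "eps > 0" using lam K L by (simp add: eps_def)
  have intercept: "ln (real (dfact k N)) - eps * t = lam * K * (t / L\<^sup>2)"
    unfolding eqt eps_def using L by (simp add: power2_eq_square field_simps)
  have sup: "superior_highly_composite k eps N"
  proof (subst superior_highly_composite_iff_ln)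
    show "\<forall>n>0. ln (real (dfact k n)) - eps * ln (real n) \<le> ln (real (dfact k N)) - eps * ln (real N)"
    proof (intro allI impI)
      fix n :: nat assume n: "n > 0"
      have "ln (real (dfact k n)) \<le> lam * K * envelope (ln (real n))" by (rule le[OF n])
      also have "\<dots> \<le> lam * K * (t / L\<^sup>2 + (L - 1) / L\<^sup>2 * ln (real n))"
        unfolding L_def using lam K n t by (intro mult_left_mono envelope_le_tangent) auto
      also have "\<dots> = lam * K * (t / L\<^sup>2) + eps * ln (real n)"
        by (simp add: eps_def algebra_simps)
      finally show "ln (real (dfact k n)) - eps * ln (real n) \<le> ln (real (dfact k N)) - eps * ln (real N)"
        using intercept unfolding t_def[symmetric] by linarith
    qed
  qed (use assms N eps in auto)
  have bound: "fratio k n \<le> lam" if "n \<ge> 3" for n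
  proof -
    have "exp 1 < (3::real)" using exp_1_le by simp
    also have "\<dots> \<le> real n" using that by simp
    finally have "exp 1 < real n" .
    then have "ln (exp 1) < ln (real n)" using that by (subst ln_less_cancel_iff) auto
    then have n: "ln (real n) > 1" by simp
    have "ln (real (dfact k n)) \<le> lam * K * envelope (ln (real n))" using that by (intro le) simp
    also have "\<dots> \<le> lam * K * (ln (real n) / ln (ln (real n)))"
      using lam K n by (intro mult_left_mono envelope_le) auto
    finally have "ln (real (dfact k n)) * ln (ln (real n)) \<le> lam * (K * ln (real n))"
      using n by (simp add: field_simps)
    then show ?thesis
      using K n by (simp add: fratio_def K_def[symmetric] divide_le_eq)
  qed
  have attained: "fratio k N = lam"
    using eqt K t_pos L unfolding fratio_def K_def[symmetric] t_def[symmetric] L_def[symmetric]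
    by simp
  have N3: "N \<ge> 3"
  proof -
    have "3 \<le> exp (2::real)" using exp_2_ge by simp
    also have "\<dots> \<le> t" by (rule t)
    also have "t \<le> real N" unfolding t_def using N ln_le_minus_one[of "real N"] by simp
    finally show ?thesis by simp
  qed
  have upper: "eps \<le> e2" if adm: "admissible k e2" for e2
  proof (rule ccontr)
    assume "\<not> eps \<le> e2"
    then have less: "e2 < eps" by simp
    obtain M where e2: "e2 > 0" and M: "superior_highly_composite k e2 M"
      and h: "ln (real (dfact k M)) - e2 * ln (real M) \<le> exp 2 * e2"
      using adm unfolding admissible_def by blast
    have "M > 0" using M by (simp add: superior_highly_composite_def)
    have "exp 2 * eps \<le> lam * K * (t / L\<^sup>2)"
    proof -
      have "L - 1 \<le> exp (L - 2)" using exp_ge_add_one_self[of "L - 2"] by simp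
      then have "exp 2 * (L - 1) \<le> exp 2 * exp (L - 2)" by (rule mult_left_mono) simp
      also have "\<dots> = t" using t_pos by (simp add: L_def flip: exp_add)
      finally have "lam * K / L\<^sup>2 * (exp 2 * (L - 1)) \<le> lam * K / L\<^sup>2 * t"
        using lam K by (intro mult_left_mono) auto
      then show ?thesis by (simp add: eps_def ac_simps)
    qed
    also have "\<dots> = ln (real (dfact k N)) - eps * t" by (rule intercept[symmetric])
    also have "\<dots> \<le> ln (real (dfact k N)) - e2 * t"
      using less t_pos by simp
    also have "\<dots> \<le> ln (real (dfact k M)) - e2 * ln (real M)"
      using M N superior_highly_composite_iff_ln[of k e2 M] assms e2 \<open>M > 0\<close> by (simp add: t_def)
    also have "\<dots> \<le> exp 2 * e2" by (rule h)
    also have "\<dots> < exp 2 * eps" using less by simp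
    finally show False by simp
  qed
  have lower: "e1 \<le> eps" if e1: "e1 \<le> \<epsilon>\<^sub>0 k" "lambda\<^sub>1 k e1 < lam" for e1
  proof (rule ccontr)
    assume "\<not> e1 \<le> eps"
    then have less: "eps < e1" by simp
    interpret small_epsilon k eps
      using assms eps less e1 by unfold_locales auto
    define C where "C = ln (c\<^sub>1 k)"
    define M where "M = C + K / eps"
    have c1: "c\<^sub>1 k > 0" using B_pos by (simp add: c_1_eq \<omega>\<^sub>2_def)
    have "t \<le> c\<^sub>1 k * real k powr (1 / eps)"
      unfolding t_def by (rule ln_superior_le_c_1[OF sup])
    then have "L \<le> ln (c\<^sub>1 k * real k powr (1 / eps))"
      unfolding L_def using t_pos by (rule ln_mono)
    also have "\<dots> = M"
      using c1 assms by (simp add: ln_mult_pos ln_powr M_def C_def K_def)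
    finally have LM: "L \<le> M" .
    have "lam = eps / K * (L\<^sup>2 / (L - 1))"
      using K L by (simp add: eps_def)
    also have "\<dots> \<le> eps / K * (M\<^sup>2 / (M - 1))"
      using eps K L LM by (intro mult_left_mono square_over_pred_mono) auto
    also have "\<dots> = lambda\<^sub>1 k eps"
    proof -
      have "K + eps * C = eps * M" "K + (C - 1) * eps = eps * (M - 1)"
        using eps by (simp_all add: M_def field_simps)
      then have "lambda\<^sub>1 k eps = (eps * M)\<^sup>2 / (K * (eps * (M - 1)))"
        by (simp add: lambda\<^sub>1_def K_def C_def)
      then show ?thesis using eps by (simp add: power2_eq_square)
    qed
    also have "\<dots> \<le> lambda\<^sub>1 k e1"
      using assms eps less e1(1) by (intro lambda_1_mono) auto
    finally show False using e1(2) by simp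
  qed
  show ?thesis
    using bound N3 attained eps sup upper lower by blast
qed

end
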